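(* Consider a network contribution game in which all reward functions are of the form $f_e(x,y)=h_e(\min(x,y))$ with differentiable and strictly concave $h_e$. Then random best response dynamics and concurrent best response dynamics converge (in the limit) to a pairwise equilibrium.
   Context: Network contribution game: a finite simple undirected graph $G=(V,E)$ with $n$ nodes and $m$ edges; every node $v\in V$ is a player with budget $B_v\ge 0$. Let $E_v$ be the set of edges incident to $v$. A strategy of $v$ is a function $s_v:E_v\to\mathbb{R}_{\ge 0}$ with $\sum_{e\in E_v}s_v(e)\le B_v$; a state $s=(s_v)_{v\in V}$ consists of one strategy per player. Each edge $e=(u,v)$ has a reward function $f_e:\mathbb{R}_{\ge 0}^2\to\mathbb{R}_{\ge 0}$; here $f_e(x,y)=h_e(\min(x,y))$ with $h_e:\mathbb{R}_{\ge0}\to\mathbb{R}_{\ge0}$ nondecreasing. The utility of $v$ is $w_v(s)=\sum_{e=(v,u)\in E_v}f_e(s_v(e),s_u(e))$. A state $s$ is a (pure) Nash equilibrium if $w_v(s)\ge w_v(s_v',s_{-v})$ for every player $v$ and every strategy $s_v'$. An improving (profitable) bilateral deviation in $s$ is a pair of strategies $(s_u',s_v')$ of two players $u\neq v$ with $w_u(s_u',s_v',s_{-u,v})>w_u(s)$ and $w_v(s_u',s_v',s_{-u,v})>w_v(s)$. A pairwise equilibrium is a Nash equilibrium that admits no improving bilateral deviation. By convention for minimum effort games, in an equilibrium both endpoints of an edge are taken to contribute the same amount to it. A bilateral best response for a pair $(u,v)$ in state $s$ is a pair $(s_u',s_v')$ that is a profitable bilateral deviation and a pair of mutual best responses: $w_u(s'_u,s'_v,s_{-u,v})\ge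 w_u(s''_u,s'_v,s_{-u,v})$ for every strategy $s''_u$ of $u$, and similarly for $v$. Dynamics (both proceed in rounds; a player or pair that gets the chance to move plays a unilateral best response, respectively a bilateral best response if one is found by the rule below). Random best response: in each round one of the $n+m$ objects (single players, pairs of adjacent players) is chosen uniformly at random and gets the chance to play a unilateral, respectively bilateral, deviation. Concurrent best response: in each round every player $v$ independently chooses, each with probability $p_v=1/(\deg_v+1)$, either to deviate unilaterally or one of its $\deg_v$ neighbors for a bilateral deviation; a bilateral deviation of $(u,v)$ can be played iff $u$ and $v$ choose each other (probability $p_u p_v$). Choice of the bilateral best response for adjacent $u,v$ with $e=(u,v)$: each of $u,v$ independently computes a unilateral best response $s_u'$, $s_v'$ under the assumption that the other player matches its contribution on $e$. The strategy of the player with the smaller value on $e$, say $u$ with $s_u'(e)\le s_v'(e)$, is fixed; then $v$ recomputes a unilateral best response under the condition $s_v'(e)\le s_u'(e)$, choosing one that matches $s_u'(e)$ on $e$. The players switch to $(s_u',s_v')$ iff this is a profitable bilateral deviation.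
   Formalization: Since best responses may place useless surplus on an edge and shuffle it forever, convergence (almost sure) is proved for the effective contributions min(s_u(e), s_v(e)); the states themselves converge when unilateral best responses place no surplus beyond the other endpoint's contribution. *)

theory Defs
  imports "HOL-Probability.Probability"
begin

type_synonym 'v edge = "'v set"
type_synonym 'v strategy = "'v edge \<Rightarrow> real"
type_synonym 'v state = "'v \<Rightarrow> 'v strategy"

record 'v contribution_game =
  players :: "'v set"
  links :: "'v edge set"
  budget :: "'v \<Rightarrow> real"
  reward :: "'v edge \<Rightarrow> real \<Rightarrow> real \<Rightarrow> real"

definition contribution_game :: "'v contribution_game \<Rightarrow> bool" where
  "contribution_game G \<longleftrightarrow>
     finite (players G) \<and>
     (\<forall>e\<in>links G. e \<subseteq> players G \<and> card e = 2) \<and>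
     (\<forall>v\<in>players G. 0 \<le> budget G v) \<and>
     (\<forall>e\<in>links G. \<forall>x\<ge>0. \<forall>y\<ge>0. 0 \<le> reward G e x y)"

definition incident :: "'v contribution_game \<Rightarrow> 'v \<Rightarrow> 'v edge set" where
  "incident G v = {e \<in> links G. v \<in> e}"

definition neighbors :: "'v contribution_game \<Rightarrow> 'v \<Rightarrow> 'v set" where
  "neighbors G v = {u. {v, u} \<in> links G}"

text \<open>Only the values of a strategy on the incident edges are meaningful; its values on
  other edges are unconstrained and never enter a utility.\<close>

definition strategies :: "'v contribution_game \<Rightarrow> 'v \<Rightarrow> 'v strategy set" where
  "strategies G v = {x \<in> incident G v \<rightarrow> {0..}. (\<Sum>e\<in>incident G v. x e) \<le> budget G v}"

definition states :: "'v contribution_game \<Rightarrow> 'v state set" where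
  "states G = {s. \<forall>v\<in>players G. s v \<in> strategies G v}"

definition utility :: "'v contribution_game \<Rightarrow> 'v \<Rightarrow> 'v state \<Rightarrow> real" where
  "utility G v s = (\<Sum>u\<in>neighbors G v. reward G {v, u} (s v {v, u}) (s u {v, u}))"

definition best_response :: "'v contribution_game \<Rightarrow> 'v state \<Rightarrow> 'v \<Rightarrow> 'v strategy \<Rightarrow> bool" where
  "best_response G s v x \<longleftrightarrow>
     x \<in> strategies G v \<and>
     (\<forall>x'\<in>strategies G v. utility G v (s(v := x')) \<le> utility G v (s(v := x)))"

definition nash_equilibrium :: "'v contribution_game \<Rightarrow> 'v state \<Rightarrow> bool" where
  "nash_equilibrium G s \<longleftrightarrow>
     s \<in> states G \<and>
     (\<forall>v\<in>players G. \<forall>x\<in>strategies G v. utility G v (s(v := x)) \<le> utility G v s)"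

definition profitable_bilateral_deviation ::
  "'v contribution_game \<Rightarrow> 'v state \<Rightarrow> 'v \<Rightarrow> 'v \<Rightarrow> 'v strategy \<Rightarrow> 'v strategy \<Rightarrow> bool" where
  "profitable_bilateral_deviation G s u v x y \<longleftrightarrow>
     x \<in> strategies G u \<and> y \<in> strategies G v \<and>
     utility G u s < utility G u (s(u := x, v := y)) \<and>
     utility G v s < utility G v (s(u := x, v := y))"

definition pairwise_equilibrium :: "'v contribution_game \<Rightarrow> 'v state \<Rightarrow> bool" where
  "pairwise_equilibrium G s \<longleftrightarrow>
     nash_equilibrium G s \<and>
     (\<forall>u\<in>players G. \<forall>v\<in>players G. u \<noteq> v \<longrightarrow>
        \<not> (\<exists>x y. profitable_bilateral_deviation G s u v x y))"

text \<open>In minimum effort games equilibria are understood to be balanced: the two endpoints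
  contribute the same amount to each edge. Any state determines a balanced one with the same
  rewards, in which the ineffective surplus on each edge is discarded.\<close>

definition balanced :: "'v contribution_game \<Rightarrow> 'v state \<Rightarrow> bool" where
  "balanced G s \<longleftrightarrow> (\<forall>v\<in>players G. \<forall>u\<in>neighbors G v. s v {v, u} = s u {v, u})"

definition effective :: "'v state \<Rightarrow> 'v state" where
  "effective s v e = Min ((\<lambda>u. s u e) ` e)"

text \<open>Best response of \<open>u\<close> under the assumption that \<open>v\<close> matches the contribution of \<open>u\<close> on
  their common edge. The strategy then ascribed to \<open>v\<close> is hypothetical and may exceed the
  budget of \<open>v\<close>.\<close>

definition assuming_match :: "'v state \<Rightarrow> 'v \<Rightarrow> 'v \<Rightarrow> 'v strategy \<Rightarrow> 'v state" where
  "assuming_match s u v x = s(u := x, v := (s v)({u, v} := x {u, v}))"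

definition matched_best_response ::
  "'v contribution_game \<Rightarrow> 'v state \<Rightarrow> 'v \<Rightarrow> 'v \<Rightarrow> 'v strategy \<Rightarrow> bool" where
  "matched_best_response G s u v x \<longleftrightarrow>
     x \<in> strategies G u \<and>
     (\<forall>x'\<in>strategies G u.
        utility G u (assuming_match s u v x') \<le> utility G u (assuming_match s u v x))"

text \<open>Outcome \<open>(x, y)\<close> of the rule for choosing a bilateral best response, where \<open>u\<close> is the
  player with the smaller value on the common edge: \<open>x\<close> is fixed, the first choice \<open>z\<close> of
  \<open>v\<close> is discarded, and \<open>y\<close> is the recomputed response of \<open>v\<close>.\<close>

definition bilateral_candidate ::
  "'v contribution_game \<Rightarrow> 'v state \<Rightarrow> 'v \<Rightarrow> 'v \<Rightarrow> 'v strategy \<Rightarrow> 'v strategy \<Rightarrow> bool" where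
  "bilateral_candidate G s u v x y \<longleftrightarrow>
     matched_best_response G s u v x \<and>
     (\<exists>z. matched_best_response G s v u z \<and> x {u, v} \<le> z {u, v}) \<and>
     y \<in> strategies G v \<and> y {u, v} = x {u, v} \<and>
     (\<forall>y'\<in>strategies G v. y' {u, v} \<le> x {u, v} \<longrightarrow>
        utility G v (s(u := x, v := y')) \<le> utility G v (s(u := x, v := y)))"

definition bilateral_move ::
  "'v contribution_game \<Rightarrow> 'v edge \<Rightarrow> 'v state \<Rightarrow> 'v state \<Rightarrow> bool" where
  "bilateral_move G e s s' \<longleftrightarrow>
     (\<exists>u v x y. e = {u, v} \<and> u \<noteq> v \<and> bilateral_candidate G s u v x y \<and>
        (if profitable_bilateral_deviation G s u v x y
         then s' u = x \<and> s' v = y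
         else s' u = s u \<and> s' v = s v))"

text \<open>One round from \<open>s\<close> to \<open>s'\<close> in which the players in \<open>I\<close> deviate unilaterally and the
  adjacent pairs in \<open>P\<close> bilaterally, all of them reacting to \<open>s\<close>. Ties between best responses
  are broken arbitrarily, so this is a relation.\<close>

type_synonym 'v chances = "'v set \<times> 'v edge set"

definition br_round :: "'v contribution_game \<Rightarrow> 'v chances \<Rightarrow> 'v state \<Rightarrow> 'v state \<Rightarrow> bool" where
  "br_round G = (\<lambda>(I, P) s s'.
     (\<forall>v\<in>I. best_response G s v (s' v)) \<and>
     (\<forall>e\<in>P. bilateral_move G e s s') \<and>
     (\<forall>v\<in>players G - (I \<union> \<Union>P). s' v = s v))"

definition br_run :: "'v contribution_game \<Rightarrow> (nat \<Rightarrow> 'v chances) \<Rightarrow> (nat \<Rightarrow> 'v state) \<Rightarrow> bool" where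
  "br_run G K X \<longleftrightarrow> X 0 \<in> states G \<and> (\<forall>t. br_round G (K t) (X t) (X (Suc t)))"

text \<open>A best response may place budget that earns nothing on an edge beyond the contribution
  of the other endpoint. In a frugal run no unilateral response does so.\<close>

definition frugal_run ::
  "'v contribution_game \<Rightarrow> (nat \<Rightarrow> 'v chances) \<Rightarrow> (nat \<Rightarrow> 'v state) \<Rightarrow> bool" where
  "frugal_run G K X \<longleftrightarrow>
     (\<forall>t. \<forall>v\<in>fst (K t). \<forall>u\<in>neighbors G v. X (Suc t) v {v, u} \<le> X t u {v, u})"

definition converges_to :: "'v contribution_game \<Rightarrow> (nat \<Rightarrow> 'v state) \<Rightarrow> 'v state \<Rightarrow> bool" where
  "converges_to G X s \<longleftrightarrow>
     (\<forall>v\<in>players G. \<forall>e\<in>incident G v. (\<lambda>t. X t v e) \<longlonglongrightarrow> s v e)"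

fun random_chances :: "'v + 'v edge \<Rightarrow> 'v chances" where
  "random_chances (Inl v) = ({v}, {})"
| "random_chances (Inr e) = ({}, {e})"

text \<open>In the concurrent dynamics \<open>c v = v\<close> means that \<open>v\<close> chooses to deviate unilaterally, and
  \<open>c v = u\<close> for a neighbor \<open>u\<close> that it chooses \<open>u\<close> for a bilateral deviation.\<close>

definition concurrent_chances :: "'v contribution_game \<Rightarrow> ('v \<Rightarrow> 'v) \<Rightarrow> 'v chances" where
  "concurrent_chances G c =
     ({v \<in> players G. c v = v}, {{u, v} | u v. {u, v} \<in> links G \<and> c u = v \<and> c v = u})"

text \<open>The process \<open>X\<close> is driven by independent random choices. The initial state and the way
  ties are broken may depend on everything, including chance.\<close>

definition random_br_dynamics ::
  "'v contribution_game \<Rightarrow> 'w measure \<Rightarrow> (nat \<Rightarrow> 'w \<Rightarrow> 'v + 'v edge) \<Rightarrow> (nat \<Rightarrow> 'w \<Rightarrow> 'v state) \<Rightarrow> bool"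
  where
  "random_br_dynamics G M C X \<longleftrightarrow>
     prob_space.indep_vars M (\<lambda>_. count_space UNIV) C UNIV \<and>
     (\<forall>t. distr M (count_space UNIV) (C t) = measure_pmf (pmf_of_set (players G <+> links G))) \<and>
     (AE \<omega> in M. br_run G (\<lambda>t. random_chances (C t \<omega>)) (\<lambda>t. X t \<omega>))"

definition concurrent_br_dynamics ::
  "'v contribution_game \<Rightarrow> 'w measure \<Rightarrow> (nat \<Rightarrow> 'v \<Rightarrow> 'w \<Rightarrow> 'v) \<Rightarrow> (nat \<Rightarrow> 'w \<Rightarrow> 'v state) \<Rightarrow> bool"
  where
  "concurrent_br_dynamics G M C X \<longleftrightarrow>
     prob_space.indep_vars M (\<lambda>_. count_space UNIV) (\<lambda>(t, v). C t v) (UNIV \<times> players G) \<and>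
     (\<forall>t. \<forall>v\<in>players G.
        distr M (count_space UNIV) (C t v) = measure_pmf (pmf_of_set (insert v (neighbors G v)))) \<and>
     (AE \<omega> in M. br_run G (\<lambda>t. concurrent_chances G (\<lambda>v. C t v \<omega>)) (\<lambda>t. X t \<omega>))"

definition strictly_concave_on :: "real set \<Rightarrow> (real \<Rightarrow> real) \<Rightarrow> bool" where
  "strictly_concave_on S f \<longleftrightarrow>
     convex S \<and>
     (\<forall>x\<in>S. \<forall>y\<in>S. x \<noteq> y \<longrightarrow>
        (\<forall>t. 0 < t \<and> t < 1 \<longrightarrow> (1 - t) * f x + t * f y < f ((1 - t) * x + t * y)))"

end

theory Submission
  imports Defs
begin

text \<open>Let every player ideally fill its links up to a common marginal reward, assuming that all
  neighbors match. The player whose level is highest asks for no more on any of its links than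
  the other endpoint does, so its ideal allocation can be imposed on these links; removing the
  player and recursing with the reduced budgets yields one target per link, together with a
  ranking of the players by decreasing level.

  In the dynamics, call a link secured if both endpoints contribute at least its target. Once all
  links of rank below k are secured, an exchange argument shows that no best response falls below
  the target of a secured link of rank at most k, and a chance of its endpoints to move jointly
  secures a link of rank k. Every object is chosen infinitely often almost surely, so rank by rank
  all links become secured after finitely many rounds. By then the owner of a link (its endpoint
  of smaller rank) has spent its budget exactly on the targets, which fixes the effective
  contributions.\<close>

section \<open>Tangents of strictly concave functions\<close>

text \<open>States need not converge: surplus above the partner's contribution earns nothing and may
  be placed anew at every response. The limit therefore concerns effective contributions, and the
  states themselves only when responses are frugal.

  For the same reason \<open>secured\<close> is one-sided. Being a lower bound on each endpoint's
  own strategy, it can be checked for each mover separately, which makes simultaneous moves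
  harmless. The matching upper bound comes from the exhausted budget of the owner.

  Concavity enters mainly through two strict tangent inequalities. Because they are strict, every
  best response reaches the target, however ties are broken, and not just some best response.
  Nothing is claimed meanwhile about links of higher rank; progress is measured by rank alone. All
  of this is deterministic for a fixed run.\<close>

definition tangent_bounds :: "(real \<Rightarrow> real) \<Rightarrow> (real \<Rightarrow> real) \<Rightarrow> bool" where
  "tangent_bounds h d \<longleftrightarrow>
     (\<forall>a b. 0 \<le> a \<and> a < b \<longrightarrow> d b * (b - a) < h b - h a \<and> h b - h a < d a * (b - a))"

lemma tangent_boundsD:
  assumes "tangent_bounds h d" "0 \<le> a" "a < b"
  shows "d b * (b - a) < h b - h a" "h b - h a < d a * (b - a)"
  using assms by (auto simp: tangent_bounds_def)

lemma tangent_bounds_antimono: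
  assumes "tangent_bounds h d" "0 \<le> a" "a < b"
  shows "d b < d a"
proof -
  have "d b * (b - a) < d a * (b - a)"
    using tangent_boundsD[OF assms] by linarith
  then show ?thesis using assms(3) by simp
qed

lemma strictly_concave_on_slope:
  assumes conc: "strictly_concave_on {0..} h" and "0 \<le> a" "a < x" "x < b"
  shows "h a + (x - a) * ((h b - h a) / (b - a)) < h x"
proof -
  define t where "t = (x - a) / (b - a)"
  have t: "0 < t" "t < 1" using assms(3,4) by (auto simp: t_def field_simps)
  have "(1 - t) * h a + t * h b < h ((1 - t) * a + t * b)"
    using conc t assms(2-4) by (simp add: strictly_concave_on_def)
  moreover have "t * (b - a) = x - a"
    using assms(3,4) by (simp add: t_def)
  then have "(1 - t) * a + t * b = x" by (simp add: algebra_simps)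
  moreover have "(1 - t) * h a + t * h b = h a + (x - a) * ((h b - h a) / (b - a))"
    by (simp add: t_def algebra_simps diff_divide_distrib add_divide_distrib)
  ultimately show ?thesis by simp
qed

text \<open>Subtracting the chord slope \<open>m\<close> gives a function \<open>g\<close> with
  equal values at both ends and larger values in between. A derivative of \<open>h\<close> below
  \<open>m\<close> at \<open>a\<close>, or above \<open>m\<close> at \<open>b\<close>, would push
  \<open>g\<close> below its end value just inside the interval. Derivatives are taken within
  \<open>{0..}\<close>, hence are one-sided at \<open>a = 0\<close>.\<close>

lemma strictly_concave_on_tangent_le:
  assumes conc: "strictly_concave_on {0..} h"
    and der: "\<And>x. 0 \<le> x \<Longrightarrow> (h has_real_derivative d x) (at x within {0..})"
    and "0 \<le> a" "a < b"
  shows "d b * (b - a) \<le> h b - h a" "h b - h a \<le> d a * (b - a)"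
proof -
  define m where "m = (h b - h a) / (b - a)"
  define g where "g x = h x - m * x" for x
  have ba: "b - a > 0" using assms(4) by simp
  have m: "h b - h a = m * (b - a)" using ba by (simp add: m_def)
  have der_g: "(g has_real_derivative d x - m) (at x within {0..})" if "0 \<le> x" for x
    unfolding g_def by (auto intro!: derivative_eq_intros der that)
  have g_ends: "g b = g a" using m by (simp add: g_def algebra_simps)
  have above: "g a < g x" if "a < x" "x < b" for x
    using strictly_concave_on_slope[OF conc assms(3) that] unfolding m_def[symmetric]
    by (simp add: g_def algebra_simps)
  have "m \<le> d a"
  proof (rule ccontr)
    assume "\<not> m \<le> d a"
    then obtain r where r: "r > 0" "\<And>e. e > 0 \<Longrightarrow> a + e \<in> {0..} \<Longrightarrow> e < r \<Longrightarrow> g (a + e) < g a"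
      using has_real_derivative_neg_dec_right[OF der_g[OF assms(3)]] by auto
    define e where "e = min r (b - a) / 2"
    have "e > 0" "e < r" "e < b - a" using r(1) ba by (auto simp: e_def min_def)
    then show False using r(2)[of e] above[of "a + e"] assms(3) by auto
  qed
  then show "h b - h a \<le> d a * (b - a)" using m ba by simp
  have "d b \<le> m"
  proof (rule ccontr)
    assume "\<not> d b \<le> m"
    then obtain r where r: "r > 0" "\<And>e. e > 0 \<Longrightarrow> b - e \<in> {0..} \<Longrightarrow> e < r \<Longrightarrow> g (b - e) < g b"
      using has_real_derivative_pos_inc_left[OF der_g[of b]] assms(3,4) by auto
    define e where "e = min r (b - a) / 2"
    have "e > 0" "e < r" "e < b - a" using r(1) ba by (auto simp: e_def min_def)
    then show False using r(2)[of e] above[of "b - e"] assms(3) g_ends by auto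
  qed
  then show "d b * (b - a) \<le> h b - h a" using m ba by simp
qed

text \<open>Strictness comes from the midpoint \<open>c\<close>: there the graph lies strictly above
  the chord, and the weak tangent bounds on the two halves turn this gap into strict bounds on the
  whole interval.\<close>

lemma strictly_concave_on_tangent_bounds:
  assumes conc: "strictly_concave_on {0..} h"
    and der: "\<And>x. 0 \<le> x \<Longrightarrow> (h has_real_derivative d x) (at x within {0..})"
  shows "tangent_bounds h d"
  unfolding tangent_bounds_def
proof (intro allI impI)
  fix a b :: real assume ab: "0 \<le> a \<and> a < b"
  define c where "c = (a + b) / 2"
  have c: "a < c" "c < b" "0 \<le> c" "c - a = (b - a) / 2" "b - c = (b - a) / 2"
    using ab by (auto simp: c_def field_simps)
  define m where "m = (h b - h a) / (b - a)"
  have m: "h b - h a = m * (b - a)" using ab by (simp add: m_def)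
  have "h a + (c - a) * m < h c"
    using strictly_concave_on_slope[OF conc, of a c b] c(1,2) ab unfolding m_def[symmetric] by simp
  then have "h a + (h b - h a) / 2 < h c" unfolding c(4) m by (simp add: mult.commute)
  moreover define p q where "p = d a * (b - a)" and "q = d b * (b - a)"
  have "h c - h a \<le> p / 2"
    using strictly_concave_on_tangent_le(2)[OF conc der _ c(1)] ab unfolding c(4) p_def by simp
  moreover have "q / 2 \<le> h b - h c"
    using strictly_concave_on_tangent_le(1)[OF conc der c(3,2)] unfolding c(5) q_def by simp
  ultimately have "q < h b - h a \<and> h b - h a < p" by argo
  then show "d b * (b - a) < h b - h a \<and> h b - h a < d a * (b - a)"
    by (simp add: p_def q_def)
qed

section \<open>Optimal allocations of a budget\<close>

lemma budget_allocation_attains_max: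
  fixes h :: "'e \<Rightarrow> real \<Rightarrow> real"
  assumes "finite S" "0 \<le> B" and cont: "\<And>e. e \<in> S \<Longrightarrow> continuous_on {0..} (h e)"
  shows "\<exists>a. a \<in> S \<rightarrow> {0..} \<and> (\<Sum>e\<in>S. a e) \<le> B \<and>
    (\<forall>y \<in> S \<rightarrow> {0..}. (\<Sum>e\<in>S. y e) \<le> B \<longrightarrow> (\<Sum>e\<in>S. h e (y e)) \<le> (\<Sum>e\<in>S. h e (a e)))"
proof -
  \<comment> \<open>Pinning the coordinates outside \<open>S\<close> to 0 makes the box compact in
    the product topology over an arbitrary index type. Inside \<open>S\<close> the bound
    \<open>B\<close> follows from nonnegativity and the budget.\<close>
  define Q where "Q = PiE UNIV (\<lambda>e. if e \<in> S then {0..B} else {0})"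
  define K where "K = Q \<inter> {y. (\<Sum>e\<in>S. y e) \<le> B}"
  have K_mem: "y e \<in> (if e \<in> S then {0..B} else {0})" if "y \<in> K" for y e
    using that by (simp add: K_def Q_def PiE_iff)
  have "compactin (product_topology (\<lambda>_. euclidean) UNIV) Q"
    unfolding Q_def by (subst compactin_PiE) auto
  then have "compact Q" by (simp add: euclidean_product_topology)
  have coord: "continuous_on A (\<lambda>y. y e)" for e :: 'e and A :: "('e \<Rightarrow> real) set"
    by (rule continuous_on_subset[OF continuous_on_product_coordinates]) simp
  have "closed {y :: 'e \<Rightarrow> real. (\<Sum>e\<in>S. y e) \<le> B}"
    by (intro closed_Collect_le continuous_intros coord)
  with \<open>compact Q\<close> have "compact K" unfolding K_def by (rule compact_Int_closed)
  moreover have "(\<lambda>_. 0) \<in> K" using assms(2) by (auto simp: K_def Q_def)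
  then have "K \<noteq> {}" by blast
  moreover have "continuous_on K (\<lambda>y. \<Sum>e\<in>S. h e (y e))"
  proof (intro continuous_on_sum)
    fix e assume "e \<in> S"
    show "continuous_on K (\<lambda>y. h e (y e))"
    proof (rule continuous_on_compose2[OF cont[OF \<open>e \<in> S\<close>] coord])
      show "(\<lambda>y. y e) ` K \<subseteq> {0..}"
      proof (rule image_subsetI)
        fix y assume "y \<in> K"
        from K_mem[OF this, of e] show "y e \<in> {0..}" using \<open>e \<in> S\<close> by simp
      qed
    qed
  qed
  ultimately obtain a where a: "a \<in> K"
    "\<And>y. y \<in> K \<Longrightarrow> (\<Sum>e\<in>S. h e (y e)) \<le> (\<Sum>e\<in>S. h e (a e))"
    using continuous_attains_sup[of K] by meson
  show ?thesis
  proof (intro exI[of _ a] conjI ballI impI)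
    show "a \<in> S \<rightarrow> {0..}"
    proof
      fix e assume "e \<in> S" then show "a e \<in> {0..}" using K_mem[OF a(1), of e] by simp
    qed
    show "(\<Sum>e\<in>S. a e) \<le> B" using a(1) by (simp add: K_def)
  next
    fix y assume y: "y \<in> S \<rightarrow> {0..}" "(\<Sum>e\<in>S. y e) \<le> B"
    define y' where "y' e = (if e \<in> S then y e else 0)" for e
    have "y e \<le> B" if "e \<in> S" for e
    proof -
      have "y e \<le> (\<Sum>e\<in>S. y e)" using that y(1) assms(1) by (intro member_le_sum) auto
      then show ?thesis using y(2) by linarith
    qed
    then have "y' \<in> K" using y by (auto simp: y'_def K_def Q_def Pi_iff)
    from a(2)[OF this] show "(\<Sum>e\<in>S. h e (y e)) \<le> (\<Sum>e\<in>S. h e (a e))"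
      by (simp add: y'_def)
  qed
qed

lemma sum_update_one:
  fixes y :: "'e \<Rightarrow> real"
  assumes "finite S" "i \<in> S" "\<And>e. e \<in> S \<Longrightarrow> e \<noteq> i \<Longrightarrow> z e = y e"
  shows "(\<Sum>e\<in>S. z e) = (\<Sum>e\<in>S. y e) + (z i - y i)"
proof -
  have "(\<Sum>e\<in>S. z e) = z i + (\<Sum>e\<in>S - {i}. z e)" using assms(1,2) by (rule sum.remove)
  also have "(\<Sum>e\<in>S - {i}. z e) = (\<Sum>e\<in>S - {i}. y e)" using assms(3) by (intro sum.cong) auto
  finally show ?thesis using sum.remove[OF assms(1,2), of y] by simp
qed

lemma sum_update_two:
  fixes y :: "'e \<Rightarrow> real"
  assumes "finite S" "i \<in> S" "j \<in> S" "i \<noteq> j" "\<And>e. e \<in> S \<Longrightarrow> e \<noteq> i \<Longrightarrow> e \<noteq> j \<Longrightarrow> z e = y e"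
  shows "(\<Sum>e\<in>S. z e) = (\<Sum>e\<in>S. y e) + (z i - y i) + (z j - y j)"
proof -
  define w where "w = y(i := z i)"
  have "(\<Sum>e\<in>S. z e) = (\<Sum>e\<in>S. w e) + (z j - w j)"
    by (rule sum_update_one[OF assms(1,3)]) (auto simp: w_def assms(5))
  moreover have "(\<Sum>e\<in>S. w e) = (\<Sum>e\<in>S. y e) + (w i - y i)"
    by (rule sum_update_one[OF assms(1,2)]) (simp add: w_def)
  ultimately show ?thesis using assms(4) by (simp add: w_def)
qed

lemma sum_less_obtain:
  fixes x y :: "'e \<Rightarrow> real"
  assumes "finite S" "(\<Sum>e\<in>S. x e) \<le> (\<Sum>e\<in>S. y e)" "i \<in> S" "y i < x i"
  obtains j where "j \<in> S" "x j < y j"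
proof -
  have "\<not> (\<forall>j\<in>S. y j \<le> x j)"
  proof
    assume "\<forall>j\<in>S. y j \<le> x j"
    then have "(\<Sum>e\<in>S. y e) < (\<Sum>e\<in>S. x e)"
      using assms(1,3,4) by (intro sum_strict_mono_ex1) auto
    then show False using assms(2) by simp
  qed
  then show ?thesis using that by (meson not_le)
qed

text \<open>The level \<open>l\<close> is read off a maximizer as its largest marginal reward,
  attained at some \<open>m\<close>. Unspent budget could be added at \<open>m\<close>, and a link
  with a positive amount and a smaller marginal reward could pass some of it to \<open>m\<close>;
  both contradict maximality. The last clause makes \<open>l\<close> the least affordable level,
  which later orders the levels of successive players.\<close>

lemma water_filling:
  fixes h d :: "'e \<Rightarrow> real \<Rightarrow> real"
  assumes S: "finite S" "S \<noteq> {}" and B: "0 \<le> B"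
    and der: "\<And>e x. e \<in> S \<Longrightarrow> 0 \<le> x \<Longrightarrow> (h e has_real_derivative d e x) (at x within {0..})"
    and tangent: "\<And>e. e \<in> S \<Longrightarrow> tangent_bounds (h e) (d e)"
    and pos: "\<And>e x. e \<in> S \<Longrightarrow> 0 \<le> x \<Longrightarrow> 0 < d e x"
  shows "\<exists>a l. (\<forall>e\<in>S. 0 \<le> a e \<and> d e (a e) \<le> l \<and> (0 < a e \<longrightarrow> d e (a e) = l)) \<and>
    (\<Sum>e\<in>S. a e) = B \<and>
    (\<forall>y L. (\<forall>e\<in>S. 0 \<le> y e \<and> d e (y e) \<le> L) \<and> (\<Sum>e\<in>S. y e) \<le> B \<longrightarrow> l \<le> L)"
proof -
  have cont: "continuous_on {0..} (h e)" if "e \<in> S" for e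
    by (rule DERIV_continuous_on[of "{0..}" _ "d e"]) (simp add: der that)
  obtain a where a: "a \<in> S \<rightarrow> {0..}" "(\<Sum>e\<in>S. a e) \<le> B"
    and max: "\<And>y. y \<in> S \<rightarrow> {0..} \<Longrightarrow> (\<Sum>e\<in>S. y e) \<le> B \<Longrightarrow>
      (\<Sum>e\<in>S. h e (y e)) \<le> (\<Sum>e\<in>S. h e (a e))"
    using budget_allocation_attains_max[of S B h, OF S(1) B cont] by auto
  have a0: "0 \<le> a e" if "e \<in> S" for e using a(1) that by auto
  define l where "l = Max ((\<lambda>e. d e (a e)) ` S)"
  have le: "d e (a e) \<le> l" if "e \<in> S" for e using S(1) that unfolding l_def by (intro Max_ge) auto
  have "l \<in> (\<lambda>e. d e (a e)) ` S" unfolding l_def using S by (intro Max_in) auto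
  then obtain m where m: "m \<in> S" "d m (a m) = l" by auto
  have full: "(\<Sum>e\<in>S. a e) = B"
  proof (rule ccontr)
    assume ne: "(\<Sum>e\<in>S. a e) \<noteq> B"
    define r where "r = B - (\<Sum>e\<in>S. a e)"
    have r: "r > 0" using a(2) ne by (simp add: r_def)
    define y where "y = a(m := a m + r)"
    have "(\<Sum>e\<in>S. y e) = (\<Sum>e\<in>S. a e) + (y m - a m)"
      by (rule sum_update_one[OF S(1) m(1)]) (simp add: y_def)
    moreover have ym: "y m = a m + r" by (simp add: y_def)
    ultimately have "(\<Sum>e\<in>S. y e) \<le> B" by (simp add: r_def)
    moreover have "y \<in> S \<rightarrow> {0..}" using a0 r by (simp add: y_def Pi_iff)
    ultimately have "(\<Sum>e\<in>S. h e (y e)) \<le> (\<Sum>e\<in>S. h e (a e))" by (intro max)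
    moreover have "(\<Sum>e\<in>S. h e (y e)) = (\<Sum>e\<in>S. h e (a e)) + (h m (y m) - h m (a m))"
      by (rule sum_update_one[OF S(1) m(1)]) (simp add: y_def)
    moreover have "0 < d m (a m + r) * r"
      using pos[OF m(1), of "a m + r"] a0[OF m(1)] r by simp
    then have "0 < h m (a m + r) - h m (a m)"
      using tangent_boundsD(1)[OF tangent[OF m(1)] a0[OF m(1)], of "a m + r"] r by simp
    ultimately show False unfolding ym by linarith
  qed
  have support: "d e (a e) = l" if e: "e \<in> S" "0 < a e" for e
  proof (rule ccontr)
    assume ne: "d e (a e) \<noteq> l"
    then have lt: "d e (a e) < d m (a m)" and em: "e \<noteq> m" using le[OF e(1)] m(2) by auto
    \<comment> \<open>With a slope \<open>mu\<close> between the two marginal rewards, the functions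
      tilted by \<open>mu\<close> increase when moving right at \<open>m\<close> and left at
      \<open>e\<close>. For a transfer of equal amounts the tilts cancel in the sum.\<close>
    obtain mu where mu: "d e (a e) < mu" "mu < d m (a m)" using dense[OF lt] by blast
    have "((\<lambda>x. h m x - mu * x) has_real_derivative d m (a m) - mu) (at (a m) within {0..})"
      using DERIV_diff[OF der[OF m(1) a0[OF m(1)]] DERIV_cmult[OF DERIV_ident, of mu]] by simp
    then obtain r1 where r1: "r1 > 0" "\<And>t. t > 0 \<Longrightarrow> a m + t \<in> {0..} \<Longrightarrow> t < r1 \<Longrightarrow>
        h m (a m) - mu * a m < h m (a m + t) - mu * (a m + t)"
      using has_real_derivative_pos_inc_right[of "\<lambda>x. h m x - mu * x" "d m (a m) - mu" "a m" "{0..}"] mu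
      by auto
    have "((\<lambda>x. h e x - mu * x) has_real_derivative d e (a e) - mu) (at (a e) within {0..})"
      using DERIV_diff[OF der[OF e(1) a0[OF e(1)]] DERIV_cmult[OF DERIV_ident, of mu]] by simp
    then obtain r2 where r2: "r2 > 0" "\<And>t. t > 0 \<Longrightarrow> a e - t \<in> {0..} \<Longrightarrow> t < r2 \<Longrightarrow>
        h e (a e) - mu * a e < h e (a e - t) - mu * (a e - t)"
      using has_real_derivative_neg_dec_left[of "\<lambda>x. h e x - mu * x" "d e (a e) - mu" "a e" "{0..}"] mu
      by auto
    define t where "t = min (min r1 r2) (a e) / 2"
    have t: "t > 0" "t < r1" "t < r2" "t \<le> a e"
      using r1(1) r2(1) e(2) unfolding t_def by linarith+
    define y where "y = a(m := a m + t, e := a e - t)"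
    have "(\<Sum>i\<in>S. y i) = (\<Sum>i\<in>S. a i) + (y m - a m) + (y e - a e)"
      by (rule sum_update_two[OF S(1) m(1) e(1) em[symmetric]]) (simp add: y_def)
    then have "(\<Sum>i\<in>S. y i) \<le> B" using a(2) em by (simp add: y_def)
    moreover have "y \<in> S \<rightarrow> {0..}" using a0 t(1,4) by (simp add: y_def Pi_iff)
    ultimately have "(\<Sum>i\<in>S. h i (y i)) \<le> (\<Sum>i\<in>S. h i (a i))" by (intro max)
    moreover have "(\<Sum>i\<in>S. h i (y i)) =
        (\<Sum>i\<in>S. h i (a i)) + (h m (y m) - h m (a m)) + (h e (y e) - h e (a e))"
      by (rule sum_update_two[OF S(1) m(1) e(1) em[symmetric]]) (simp add: y_def)
    moreover have "h m (a m) - mu * a m < h m (a m + t) - mu * (a m + t)"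
      using r1(2)[of t] t(1,2) a0[OF m(1)] by simp
    moreover have "h e (a e) - mu * a e < h e (a e - t) - mu * (a e - t)"
      using r2(2)[of t] t(1,3,4) by simp
    moreover have "y m = a m + t" "y e = a e - t" using em by (simp_all add: y_def)
    ultimately show False by (simp add: algebra_simps)
  qed
  have "l \<le> L" if y: "\<And>e. e \<in> S \<Longrightarrow> 0 \<le> y e" "(\<Sum>e\<in>S. y e) \<le> B"
    "\<And>e. e \<in> S \<Longrightarrow> d e (y e) \<le> L" for y L
  proof (rule ccontr)
    assume "\<not> l \<le> L"
    then have lt: "L < l" by simp
    \<comment> \<open>Pushing the marginal reward at \<open>m\<close> below \<open>l\<close> takes
      more than \<open>a m\<close>, which must be withdrawn from another link; there
      \<open>a\<close> is positive and the marginal reward rises above \<open>l\<close>.\<close>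
    have "a m < y m"
    proof (rule ccontr)
      assume "\<not> a m < y m"
      then have "d m (a m) \<le> d m (y m)"
        using tangent_bounds_antimono[OF tangent[OF m(1)] y(1)[OF m(1)], of "a m"]
        by (cases "a m = y m") auto
      then show False using y(3)[OF m(1)] m(2) lt by simp
    qed
    then obtain e where e: "e \<in> S" "y e < a e"
      using sum_less_obtain[OF S(1) _ m(1), of y a] y(2) full by auto
    then have "d e (a e) < d e (y e)"
      using tangent_bounds_antimono[OF tangent[OF e(1)] y(1)[OF e(1)]] by simp
    moreover have "d e (a e) = l" using support e y(1)[OF e(1)] by simp
    ultimately show False using y(3)[OF e(1)] lt by simp
  qed
  then have "\<forall>y L. (\<forall>e\<in>S. 0 \<le> y e \<and> d e (y e) \<le> L) \<and> (\<Sum>e\<in>S. y e) \<le> B \<longrightarrow> l \<le> L"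
    by blast
  moreover have "\<forall>e\<in>S. 0 \<le> a e \<and> d e (a e) \<le> l \<and> (0 < a e \<longrightarrow> d e (a e) = l)"
    using a0 le support by blast
  ultimately show ?thesis using full by (intro exI[of _ a] exI[of _ l] conjI)
qed

text \<open>Exchange argument on the effective part \<open>w\<close> of the optimum. If it falls
  short of \<open>x i\<close>, then either some \<open>w j\<close> exceeds \<open>x j\<close>, so
  the cap on \<open>j\<close> is not reached by \<open>x\<close> and shifting from \<open>j\<close>
  to \<open>i\<close> pays by \<open>level\<close>; or \<open>w\<close> stays at or below
  \<open>x\<close> everywhere, and raising \<open>i\<close> to \<open>x i\<close> is affordable
  because \<open>x\<close> is.\<close>

lemma capped_optimum_ge:
  fixes h d :: "'e \<Rightarrow> real \<Rightarrow> real"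
  assumes S: "finite S"
    and tangent: "\<And>e. e \<in> S \<Longrightarrow> tangent_bounds (h e) (d e)"
    and pos: "\<And>e x. e \<in> S \<Longrightarrow> 0 \<le> x \<Longrightarrow> 0 < d e x"
    and c: "\<And>e. e \<in> S \<Longrightarrow> 0 \<le> c e"
    and y: "y \<in> S \<rightarrow> {0..}" "(\<Sum>e\<in>S. y e) \<le> B"
    and opt: "\<And>z. z \<in> S \<rightarrow> {0..} \<Longrightarrow> (\<Sum>e\<in>S. z e) \<le> B \<Longrightarrow>
      (\<Sum>e\<in>S. h e (min (z e) (c e))) \<le> (\<Sum>e\<in>S. h e (min (y e) (c e)))"
    and x: "\<And>e. e \<in> S \<Longrightarrow> 0 \<le> x e" "(\<Sum>e\<in>S. x e) \<le> B"
    and i: "i \<in> S" "x i \<le> c i"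
    and level: "\<And>e. e \<in> S \<Longrightarrow> x e < c e \<Longrightarrow> 0 < x i \<Longrightarrow> d e (x e) \<le> d i (x i)"
  shows "x i \<le> y i"
proof (rule ccontr)
  assume "\<not> x i \<le> y i"
  then have lt: "y i < x i" by simp
  define w where "w e = min (y e) (c e)" for e
  have w: "0 \<le> w e" "w e \<le> c e" "w e \<le> y e" if "e \<in> S" for e
    using y(1) c that by (auto simp: w_def)
  have wi: "w i < x i" "0 \<le> w i" using lt w[OF i(1)] by auto
  have gain: "h i b - h i a > d i (x i) * (b - a)" if "0 \<le> a" "a < b" "b \<le> x i" for a b
  proof -
    have "d i (x i) \<le> d i b"
      using tangent_bounds_antimono[OF tangent[OF i(1)], of b "x i"] that by (cases "b = x i") auto
    then have "d i (x i) * (b - a) \<le> d i b * (b - a)" using that by (intro mult_right_mono) auto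
    then show ?thesis using tangent_boundsD(1)[OF tangent[OF i(1)] that(1,2)] by linarith
  qed
  show False
  proof (cases "\<exists>j\<in>S. x j < w j")
    case True
    then obtain j where j: "j \<in> S" "x j < w j" by blast
    have ij: "i \<noteq> j" using j wi by auto
    \<comment> \<open>The transfer stops at the first of the two comparison values, so the marginal
      rewards involved are at least \<open>d i (x i)\<close> on \<open>i\<close> and at most
      \<open>d j (x j)\<close> on \<open>j\<close>.\<close>
    define t where "t = min (x i - w i) (w j - x j)"
    have t: "t > 0" "w i + t \<le> x i" "x j \<le> w j - t" using wi j by (auto simp: t_def)
    define z where "z = w(i := w i + t, j := w j - t)"
    have z_le: "z e \<le> c e" if "e \<in> S" for e
      using w[OF that] t i by (auto simp: z_def)
    have "(\<Sum>e\<in>S. z e) = (\<Sum>e\<in>S. w e) + (z i - w i) + (z j - w j)"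
      by (rule sum_update_two[OF S i(1) j(1) ij]) (simp add: z_def)
    also have "\<dots> = (\<Sum>e\<in>S. w e)" using ij by (simp add: z_def)
    also have "\<dots> \<le> (\<Sum>e\<in>S. y e)" using w by (intro sum_mono)
    finally have "(\<Sum>e\<in>S. z e) \<le> B" using y(2) by simp
    moreover have "z \<in> S \<rightarrow> {0..}"
      using w t x(1)[OF j(1)] wi by (auto simp: z_def)
    ultimately have "(\<Sum>e\<in>S. h e (min (z e) (c e))) \<le> (\<Sum>e\<in>S. h e (w e))"
      using opt[of z] by (simp add: w_def)
    then have "(\<Sum>e\<in>S. h e (z e)) \<le> (\<Sum>e\<in>S. h e (w e))"
      using z_le by (simp add: min_absorb1)
    moreover have "(\<Sum>e\<in>S. h e (z e)) =
        (\<Sum>e\<in>S. h e (w e)) + (h i (z i) - h i (w i)) + (h j (z j) - h j (w j))"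
      by (rule sum_update_two[OF S i(1) j(1) ij]) (simp add: z_def)
    moreover have "h i (w i + t) - h i (w i) > d i (x i) * t"
      using gain[of "w i" "w i + t"] wi t by simp
    moreover have "h j (w j) - h j (w j - t) < d j (x j) * t"
    proof -
      have "d j (w j - t) \<le> d j (x j)"
        using tangent_bounds_antimono[OF tangent[OF j(1)] x(1)[OF j(1)], of "w j - t"] t
        by (cases "w j - t = x j") auto
      then have "d j (w j - t) * t \<le> d j (x j) * t" using t(1) by (intro mult_right_mono) auto
      moreover have "h j (w j) - h j (w j - t) < d j (w j - t) * t"
        using tangent_boundsD(2)[OF tangent[OF j(1)], of "w j - t" "w j"] t x(1)[OF j(1)] by simp
      ultimately show ?thesis by linarith
    qed
    moreover have "d j (x j) * t \<le> d i (x i) * t"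
      using level[OF j(1)] j(2) w[OF j(1)] wi t(1) by (intro mult_right_mono) auto
    ultimately show False using ij by (simp add: z_def)
  next
    case False
    define z where "z = w(i := x i)"
    have z_le: "z e \<le> c e" if "e \<in> S" for e
      using w[OF that] i by (auto simp: z_def)
    have "(\<Sum>e\<in>S. z e) \<le> (\<Sum>e\<in>S. x e)"
      using False by (intro sum_mono) (auto simp: z_def not_less)
    then have "(\<Sum>e\<in>S. z e) \<le> B" using x(2) by simp
    moreover have "z \<in> S \<rightarrow> {0..}" using w x(1)[OF i(1)] by (auto simp: z_def)
    ultimately have "(\<Sum>e\<in>S. h e (min (z e) (c e))) \<le> (\<Sum>e\<in>S. h e (w e))"
      using opt[of z] by (simp add: w_def)
    then have "(\<Sum>e\<in>S. h e (z e)) \<le> (\<Sum>e\<in>S. h e (w e))"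
      using z_le by (simp add: min_absorb1)
    moreover have "(\<Sum>e\<in>S. h e (z e)) = (\<Sum>e\<in>S. h e (w e)) + (h i (z i) - h i (w i))"
      by (rule sum_update_one[OF S i(1)]) (simp add: z_def)
    moreover have "0 < d i (x i) * (x i - w i)"
      using pos[OF i(1) x(1)[OF i(1)]] wi by simp
    then have "0 < h i (x i) - h i (w i)"
      using gain[of "w i" "x i"] wi by linarith
    ultimately show False by (simp add: z_def)
  qed
qed

section \<open>The target profile\<close>

definition edge_rank :: "('v \<Rightarrow> nat) \<Rightarrow> 'v set \<Rightarrow> nat" where
  "edge_rank r e = Min (r ` e)"

lemma edge_rank_doubleton [simp]: "edge_rank r {u, w} = min (r u) (r w)"
  by (simp add: edge_rank_def)

lemma edge_rank_push:
  assumes "card e = 2"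
  shows "edge_rank (\<lambda>u. if u = v then 0 else Suc (r u)) e =
    (if v \<in> e then 0 else Suc (edge_rank r e))"
proof -
  obtain u w where "e = {u, w}" using assms by (auto simp: card_2_iff)
  then show ?thesis by auto
qed

text \<open>A link is owned by its endpoint of smaller rank. Levels of marginal reward decrease with the
  rank, and every owner spends its whole budget on the targets.\<close>

definition ranked_profile ::
  "('v set \<Rightarrow> real \<Rightarrow> real) \<Rightarrow> 'v set set \<Rightarrow> 'v set \<Rightarrow> ('v \<Rightarrow> real) \<Rightarrow> ('v set \<Rightarrow> real) \<Rightarrow> ('v \<Rightarrow> nat) \<Rightarrow> bool"
  where
  "ranked_profile d E V b x r \<longleftrightarrow>
     (\<forall>e\<in>E. 0 \<le> x e) \<and>
     (\<forall>v\<in>V. (\<Sum>e | e \<in> E \<and> v \<in> e. x e) \<le> b v) \<and>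
     (\<forall>u w. {u, w} \<in> E \<longrightarrow> r u \<noteq> r w) \<and>
     (\<forall>e\<in>E. \<forall>f\<in>E. edge_rank r e \<le> edge_rank r f \<longrightarrow> 0 < x e \<longrightarrow> d f (x f) \<le> d e (x e)) \<and>
     (\<forall>u w. {u, w} \<in> E \<longrightarrow> r u < r w \<longrightarrow> (\<Sum>e | e \<in> E \<and> u \<in> e. x e) = b u)"

text \<open>Since \<open>l\<close> is the marginal reward on the supported links of \<open>v\<close>
  and bounds it on all other links, \<open>v\<close> can be placed in front of the ranking of the
  remaining players without breaking the order of levels.\<close>

lemma ranked_profile_step:
  fixes d :: "'v set \<Rightarrow> real \<Rightarrow> real"
  assumes E: "\<And>e. e \<in> E \<Longrightarrow> card e = 2" "finite E"
    and a: "\<And>e. e \<in> E \<Longrightarrow> v \<in> e \<Longrightarrow> 0 \<le> a e"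
      "\<And>e. e \<in> E \<Longrightarrow> v \<in> e \<Longrightarrow> 0 < a e \<Longrightarrow> d e (a e) = l"
      "\<And>e. e \<in> E \<Longrightarrow> v \<in> e \<Longrightarrow> d e (a e) \<le> l"
      "(\<Sum>e | e \<in> E \<and> v \<in> e. a e) = b v"
    and x: "ranked_profile d {e \<in> E. v \<notin> e} (V - {v})
        (\<lambda>u. b u - (if {u, v} \<in> E then a {u, v} else 0)) x r"
      "\<And>e. e \<in> E \<Longrightarrow> v \<notin> e \<Longrightarrow> d e (x e) \<le> l"
  shows "ranked_profile d E V b (\<lambda>e. if v \<in> e then a e else x e)
    (\<lambda>u. if u = v then 0 else Suc (r u))"
proof -
  define x' where "x' e = (if v \<in> e then a e else x e)" for e
  define r' where "r' u = (if u = v then 0 else Suc (r u))" for u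
  define E' where "E' = {e \<in> E. v \<notin> e}"
  define b' where "b' u = b u - (if {u, v} \<in> E then a {u, v} else 0)" for u
  have x: "ranked_profile d E' (V - {v}) b' x r" "\<And>e. e \<in> E' \<Longrightarrow> d e (x e) \<le> l"
    unfolding E'_def b'_def using x by auto
  have er: "edge_rank r' e = (if v \<in> e then 0 else Suc (edge_rank r e))" if "e \<in> E" for e
    unfolding r'_def by (rule edge_rank_push[OF E(1)[OF that]])
  have bound: "d e (x' e) \<le> l" if "e \<in> E" for e
    using that a(3) x(2) by (auto simp: x'_def E'_def)
  have sum_v: "(\<Sum>e | e \<in> E \<and> v \<in> e. x' e) = b v"
  proof -
    have "(\<Sum>e | e \<in> E \<and> v \<in> e. x' e) = (\<Sum>e | e \<in> E \<and> v \<in> e. a e)"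
      by (intro sum.cong) (simp_all add: x'_def)
    then show ?thesis using a(4) by simp
  qed
  \<comment> \<open>A player other than \<open>v\<close> shares at most one link with
    \<open>v\<close>, so its total grows by exactly what \<open>b'\<close> deducted.\<close>
  have sum_u: "(\<Sum>e | e \<in> E \<and> u \<in> e. x' e) = (\<Sum>e | e \<in> E' \<and> u \<in> e. x e) + (b u - b' u)"
    if "u \<noteq> v" for u
  proof -
    have only: "e = {u, v}" if "e \<in> E" "u \<in> e" "v \<in> e" for e
      using E(1)[OF that(1)] that \<open>u \<noteq> v\<close> by (auto simp: card_2_iff)
    have split: "{e. e \<in> E \<and> u \<in> e} = {e. e \<in> E' \<and> u \<in> e} \<union> (if {u, v} \<in> E then {{u, v}} else {})"
    proof (cases "{u, v} \<in> E")
      case True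
      then show ?thesis unfolding E'_def if_P[OF True] using only by blast
    next
      case False
      then show ?thesis unfolding E'_def if_not_P[OF False] using only by blast
    qed
    have "(\<Sum>e | e \<in> E \<and> u \<in> e. x' e) = (\<Sum>e | e \<in> E' \<and> u \<in> e. x' e)
        + (\<Sum>e\<in>(if {u, v} \<in> E then {{u, v}} else {}). x' e)"
      unfolding split by (rule sum.union_disjoint) (use E(2) in \<open>auto simp: E'_def\<close>)
    also have "(\<Sum>e | e \<in> E' \<and> u \<in> e. x' e) = (\<Sum>e | e \<in> E' \<and> u \<in> e. x e)"
      by (intro sum.cong) (auto simp: E'_def x'_def)
    finally show ?thesis by (simp add: b'_def x'_def)
  qed
  have "0 \<le> x' e" if "e \<in> E" for e
    using that a(1) x(1) by (auto simp: x'_def ranked_profile_def E'_def)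
  moreover have "(\<Sum>e | e \<in> E \<and> u \<in> e. x' e) \<le> b u" if "u \<in> V" for u
    using that x(1) sum_v sum_u[of u] by (cases "u = v") (auto simp: ranked_profile_def)
  moreover have "r' u \<noteq> r' w" if uw: "{u, w} \<in> E" for u w
  proof -
    have "u \<noteq> w" using E(1)[OF uw] by (auto simp: card_2_iff)
    moreover have "r u \<noteq> r w" if "u \<noteq> v" "w \<noteq> v"
      using uw that x(1) by (auto simp: ranked_profile_def E'_def)
    ultimately show ?thesis by (auto simp: r'_def)
  qed
  moreover have "d f (x' f) \<le> d e (x' e)"
    if ef: "e \<in> E" "f \<in> E" "edge_rank r' e \<le> edge_rank r' f" "0 < x' e" for e f
  proof (cases "v \<in> e")
    case True
    then have "d e (x' e) = l" using a(2) ef by (simp add: x'_def)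
    then show ?thesis using bound[OF ef(2)] by simp
  next
    case False
    then have "v \<notin> f" "edge_rank r e \<le> edge_rank r f"
      using ef by (auto simp: er split: if_splits)
    with False show ?thesis using ef x(1) by (simp add: ranked_profile_def E'_def x'_def)
  qed
  moreover have "(\<Sum>e | e \<in> E \<and> u \<in> e. x' e) = b u" if uw: "{u, w} \<in> E" "r' u < r' w" for u w
  proof (cases "u = v")
    case True
    then show ?thesis using sum_v by simp
  next
    case False
    then have "w \<noteq> v" "r u < r w" using uw(2) by (auto simp: r'_def split: if_splits)
    then have "(\<Sum>e | e \<in> E' \<and> u \<in> e. x e) = b' u"
      using uw(1) False x(1) by (auto simp: ranked_profile_def E'_def)
    then show ?thesis using sum_u[OF False] by simp
  qed
  ultimately have "ranked_profile d E V b x' r'" unfolding ranked_profile_def by blast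
  then show ?thesis unfolding x'_def r'_def .
qed

text \<open>The bound \<open>L\<close> is generalized in the induction: if every player can afford
  level \<open>L\<close>, the highest ideal level is at most \<open>L\<close>, and that level
  becomes the bound for the game without its player. This makes the levels decrease along the
  recursion.\<close>

lemma ranked_profile_exists:
  fixes h d :: "'v set \<Rightarrow> real \<Rightarrow> real"
  assumes "finite V" "\<And>e. e \<in> E \<Longrightarrow> e \<subseteq> V \<and> card e = 2"
    and der: "\<And>e z. e \<in> E \<Longrightarrow> 0 \<le> z \<Longrightarrow> (h e has_real_derivative d e z) (at z within {0..})"
    and tangent: "\<And>e. e \<in> E \<Longrightarrow> tangent_bounds (h e) (d e)"
    and pos: "\<And>e z. e \<in> E \<Longrightarrow> 0 \<le> z \<Longrightarrow> 0 < d e z"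
    and "\<forall>v\<in>V. \<exists>y. (\<forall>e\<in>E. v \<in> e \<longrightarrow> 0 \<le> y e \<and> d e (y e) \<le> L) \<and>
        (\<Sum>e | e \<in> E \<and> v \<in> e. y e) \<le> b v"
  shows "\<exists>x r. ranked_profile d E V b x r \<and> (\<forall>e\<in>E. d e (x e) \<le> L)"
  using assms
proof (induction "card V" arbitrary: V E b L)
  case 0
  then have "V = {}" by simp
  then have "E = {}" using "0.prems"(2) by force
  then show ?case using \<open>V = {}\<close> by (simp add: ranked_profile_def)
next
  case (Suc n)
  note fin = \<open>finite V\<close> and E = Suc.prems(2) and der = Suc.prems(3)
    and tangent = Suc.prems(4) and pos = Suc.prems(5)
  have finE: "finite E"
    by (rule finite_subset[of _ "Pow V"]) (use E fin in auto)
  show ?case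
  proof (cases "E = {}")
    case True
    have "0 \<le> b v" if "v \<in> V" for v using Suc.prems(6) that True by simp
    then show ?thesis using True
      by (intro exI[of _ "\<lambda>_. 0"]) (simp add: ranked_profile_def)
  next
    case False
    define S where "S v = {e. e \<in> E \<and> v \<in> e}" for v
    \<comment> \<open>Only players with at least one link have an ideal level.\<close>
    define D where "D = {v \<in> V. S v \<noteq> {}}"
    obtain e0 where e0: "e0 \<in> E" using False by blast
    then have "e0 \<subseteq> V" "e0 \<noteq> {}" using E[OF e0] by auto
    then obtain v0 where "v0 \<in> e0" "v0 \<in> V" by blast
    then have D: "finite D" "D \<noteq> {}" using e0 fin by (auto simp: D_def S_def)
    define ideal where "ideal v a l \<longleftrightarrow>
      (\<forall>e\<in>S v. 0 \<le> a e \<and> d e (a e) \<le> l \<and> (0 < a e \<longrightarrow> d e (a e) = l)) \<and> (\<Sum>e\<in>S v. a e) = b v \<and>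
      (\<forall>y L. (\<forall>e\<in>S v. 0 \<le> y e \<and> d e (y e) \<le> L) \<and> (\<Sum>e\<in>S v. y e) \<le> b v \<longrightarrow> l \<le> L)" for v a l
    have afford: "\<exists>y. (\<forall>e\<in>S v. 0 \<le> y e \<and> d e (y e) \<le> L) \<and> (\<Sum>e\<in>S v. y e) \<le> b v" if v: "v \<in> V" for v
    proof -
      obtain y where "\<forall>e\<in>E. v \<in> e \<longrightarrow> 0 \<le> y e \<and> d e (y e) \<le> L"
        "(\<Sum>e | e \<in> E \<and> v \<in> e. y e) \<le> b v"
        using bspec[OF Suc.prems(6) v] by (elim exE conjE)
      then show ?thesis unfolding S_def by (intro exI[of _ y]) simp
    qed
    have b0: "0 \<le> b v" if v: "v \<in> V" for v
    proof -
      obtain y where y: "\<forall>e\<in>S v. 0 \<le> y e \<and> d e (y e) \<le> L" "(\<Sum>e\<in>S v. y e) \<le> b v"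
        using afford[OF v] by blast
      have "0 \<le> (\<Sum>e\<in>S v. y e)" using y(1) by (intro sum_nonneg) blast
      then show ?thesis using y(2) by simp
    qed
    have "\<exists>a l. ideal v a l" if v: "v \<in> D" for v
      unfolding ideal_def
    proof (rule water_filling[where h = h and d = d])
      show "finite (S v)" "S v \<noteq> {}" "0 \<le> b v" using v b0 finE by (auto simp: D_def S_def)
    qed (use der tangent pos in \<open>auto simp: S_def\<close>)
    then obtain a l where al: "\<And>v. v \<in> D \<Longrightarrow> ideal v (a v) (l v)" by metis
    have "Max (l ` D) \<in> l ` D" using D by (intro Max_in) auto
    then obtain v where v: "v \<in> D" "l v = Max (l ` D)" by auto
    have vmax: "l u \<le> l v" if "u \<in> D" for u unfolding v(2) using D that by simp
    have vV: "v \<in> V" using v by (simp add: D_def)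
    have idv: "ideal v (a v) (l v)" using al v by blast
    obtain y where y: "\<forall>e\<in>S v. 0 \<le> y e \<and> d e (y e) \<le> L" "(\<Sum>e\<in>S v. y e) \<le> b v"
      using afford[OF vV] by blast
    have "\<forall>y L. (\<forall>e\<in>S v. 0 \<le> y e \<and> d e (y e) \<le> L) \<and> (\<Sum>e\<in>S v. y e) \<le> b v \<longrightarrow> l v \<le> L"
      using idv unfolding ideal_def by (elim conjE)
    from this[rule_format, of y L] have lL: "l v \<le> L" using y by blast
    define E' where "E' = {e \<in> E. v \<notin> e}"
    define b' where "b' u = b u - (if {u, v} \<in> E then a v {u, v} else 0)" for u
    \<comment> \<open>The highest level asks for least: with a larger ask than \<open>u\<close>,
      player \<open>v\<close> would be at marginal reward exactly \<open>l v\<close>, strictly below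
      that of \<open>u\<close> at its smaller ask, which is at most \<open>l u\<close>.\<close>
    have le: "a v {u, v} \<le> a u {u, v}" if uv: "{u, v} \<in> E" "u \<in> D" for u
    proof (rule ccontr)
      let ?e = "{u, v}"
      assume "\<not> ?thesis"
      then have lt: "a u ?e < a v ?e" by simp
      have mem: "?e \<in> S u" "?e \<in> S v" using uv by (auto simp: S_def)
      have idu: "ideal u (a u) (l u)" using al uv by blast
      have u0: "0 \<le> a u ?e" using idu mem by (simp add: ideal_def)
      have "d ?e (a v ?e) = l v" using idv mem u0 lt by (auto simp: ideal_def)
      moreover have "d ?e (a u ?e) \<le> l u" using idu mem by (simp add: ideal_def)
      moreover have "d ?e (a v ?e) < d ?e (a u ?e)"
        by (rule tangent_bounds_antimono[OF tangent[OF uv(1)] u0 lt])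
      ultimately show False using vmax[OF uv(2)] by linarith
    qed
    have "\<exists>x r. ranked_profile d E' (V - {v}) b' x r \<and> (\<forall>e\<in>E'. d e (x e) \<le> l v)"
    proof (rule Suc.hyps(1))
      show "n = card (V - {v})" using Suc.hyps(2) vV fin by simp
      show "\<forall>u\<in>V - {v}. \<exists>y. (\<forall>e\<in>E'. u \<in> e \<longrightarrow> 0 \<le> y e \<and> d e (y e) \<le> l v) \<and>
        (\<Sum>e | e \<in> E' \<and> u \<in> e. y e) \<le> b' u"
      proof
        fix u assume u: "u \<in> V - {v}"
        show "\<exists>y. (\<forall>e\<in>E'. u \<in> e \<longrightarrow> 0 \<le> y e \<and> d e (y e) \<le> l v) \<and>
          (\<Sum>e | e \<in> E' \<and> u \<in> e. y e) \<le> b' u"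
        proof (cases "u \<in> D")
          case False
          then have no: "S u = {}" using u by (simp add: D_def)
          then have "{u, v} \<notin> E" "{e. e \<in> E' \<and> u \<in> e} = {}" by (auto simp: S_def E'_def)
          then have "(\<Sum>e | e \<in> E' \<and> u \<in> e. 0) \<le> b' u" using b0[of u] u by (simp add: b'_def)
          then show ?thesis using no by (intro exI[of _ "\<lambda>_. 0"]) (auto simp: S_def E'_def)
        next
          case True
          have idu: "ideal u (a u) (l u)" using al True by blast
          \<comment> \<open>The ideal allocation of \<open>u\<close> itself shows that level
            \<open>l v\<close> stays affordable: dropping the link to \<open>v\<close> frees at
            least what was deducted from the budget of \<open>u\<close>.\<close>
          have "0 \<le> a u e \<and> d e (a u e) \<le> l v" if "e \<in> E'" "u \<in> e" for e
          proof -
            have "e \<in> S u" using that by (simp add: S_def E'_def)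
            then have "0 \<le> a u e" "d e (a u e) \<le> l u" using idu by (auto simp: ideal_def)
            then show ?thesis using vmax[OF True] by simp
          qed
          moreover have "(\<Sum>e | e \<in> E' \<and> u \<in> e. a u e) \<le> b' u"
          proof (cases "{u, v} \<in> E")
            case uv: True
            have "(\<Sum>e | e \<in> E' \<and> u \<in> e. a u e) + a u {u, v} =
                (\<Sum>e\<in>insert {u, v} {e. e \<in> E' \<and> u \<in> e}. a u e)"
              using finE by (simp add: E'_def)
            also have "\<dots> \<le> (\<Sum>e\<in>S u. a u e)"
              using finE uv idu by (intro sum_mono2) (auto simp: E'_def S_def ideal_def)
            also have "\<dots> = b u" using idu by (simp add: ideal_def)
            finally show ?thesis using le[OF uv True] uv by (simp add: b'_def)
          next
            case uv: False
            have "(\<Sum>e | e \<in> E' \<and> u \<in> e. a u e) \<le> (\<Sum>e\<in>S u. a u e)"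
              using finE idu by (intro sum_mono2) (auto simp: E'_def S_def ideal_def)
            also have "\<dots> = b u" using idu by (simp add: ideal_def)
            finally show ?thesis using uv by (simp add: b'_def)
          qed
          ultimately show ?thesis by (intro exI[of _ "a u"]) blast
        qed
      qed
    qed (use fin E der tangent pos in \<open>auto simp: E'_def\<close>)
    then obtain x r where x: "ranked_profile d E' (V - {v}) b' x r" "\<And>e. e \<in> E' \<Longrightarrow> d e (x e) \<le> l v"
      by blast
    have "ranked_profile d E V b (\<lambda>e. if v \<in> e then a v e else x e) (\<lambda>u. if u = v then 0 else Suc (r u))"
    proof (rule ranked_profile_step[where l = "l v"])
      show "ranked_profile d {e \<in> E. v \<notin> e} (V - {v})
          (\<lambda>u. b u - (if {u, v} \<in> E then a v {u, v} else 0)) x r"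
        using x(1) unfolding E'_def b'_def .
      show "(\<Sum>e | e \<in> E \<and> v \<in> e. a v e) = b v" using idv by (simp add: ideal_def S_def)
      show "0 \<le> a v e" "d e (a v e) \<le> l v" if "e \<in> E" "v \<in> e" for e
        using idv that by (simp_all add: ideal_def S_def)
      show "d e (a v e) = l v" if "e \<in> E" "v \<in> e" "0 < a v e" for e
        using idv that by (simp add: ideal_def S_def)
      show "d e (x e) \<le> l v" if "e \<in> E" "v \<notin> e" for e using that x(2) by (simp add: E'_def)
    qed (use E finE in auto)
    moreover have "d e (if v \<in> e then a v e else x e) \<le> L" if "e \<in> E" for e
      using idv that lL x(2)[of e] by (auto simp: ideal_def S_def E'_def)
    ultimately show ?thesis by blast
  qed
qed

section \<open>Best responses in minimum effort games\<close>

locale min_effort_game =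
  fixes G :: "'v contribution_game" and h d :: "'v edge \<Rightarrow> real \<Rightarrow> real"
  assumes game: "contribution_game G"
    and reward: "e \<in> links G \<Longrightarrow> 0 \<le> a \<Longrightarrow> 0 \<le> b \<Longrightarrow> reward G e a b = h e (min a b)"
    and tangent: "e \<in> links G \<Longrightarrow> tangent_bounds (h e) (d e)"
    and pos: "e \<in> links G \<Longrightarrow> 0 \<le> a \<Longrightarrow> 0 < d e a"
begin

lemma finite_players: "finite (players G)"
  using game by (simp add: contribution_game_def)

lemma link_props: "e \<in> links G \<Longrightarrow> e \<subseteq> players G \<and> card e = 2"
  using game by (simp add: contribution_game_def)

lemma finite_links: "finite (links G)"
  by (rule finite_subset[of _ "Pow (players G)"]) (use link_props finite_players in auto)

lemma link_doubletonD:
  assumes "{u, v} \<in> links G"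
  shows "u \<noteq> v" "u \<in> players G" "v \<in> players G"
  using link_props[OF assms] by (auto simp: card_2_iff doubleton_eq_iff)

lemma incident_obtain:
  assumes "e \<in> incident G v"
  obtains u where "e = {v, u}" "u \<noteq> v" "{v, u} \<in> links G" "u \<in> players G" "v \<in> players G"
proof -
  have e: "e \<in> links G" "v \<in> e" using assms by (auto simp: incident_def)
  obtain a b where ab: "e = {a, b}" "a \<noteq> b" using link_props[OF e(1)] by (auto simp: card_2_iff)
  define u where "u = (if v = a then b else a)"
  have "e = {v, u}" using ab e(2) by (auto simp: u_def)
  then show ?thesis using that link_doubletonD[of v u] e(1) by metis
qed

lemma finite_incident: "finite (incident G v)"
  using finite_links by (simp add: incident_def)

lemma sum_neighbors: "(\<Sum>u\<in>neighbors G v. f {v, u}) = (\<Sum>e\<in>incident G v. f e)"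
proof (rule sum.reindex_bij_betw[of "\<lambda>u. {v, u}" "neighbors G v" "incident G v" f])
  show "bij_betw (\<lambda>u. {v, u}) (neighbors G v) (incident G v)"
    unfolding bij_betw_def
  proof
    show "inj_on (\<lambda>u. {v, u}) (neighbors G v)" by (auto simp: inj_on_def doubleton_eq_iff)
    show "(\<lambda>u. {v, u}) ` neighbors G v = incident G v"
      by (auto simp: neighbors_def incident_def elim!: incident_obtain[unfolded incident_def])
  qed
qed

section \<open>Utility as gain against caps\<close>

definition opposite :: "'v state \<Rightarrow> 'v \<Rightarrow> 'v edge \<Rightarrow> real" where
  "opposite s v e = s (THE u. u \<in> e \<and> u \<noteq> v) e"

lemma opposite_doubleton:
  assumes "u \<noteq> v"
  shows "opposite s v {v, u} = s u {v, u}" "opposite s v {u, v} = s u {v, u}"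
proof -
  have "(THE w. w \<in> {v, u} \<and> w \<noteq> v) = u" by (rule the_equality) (use assms in auto)
  then show "opposite s v {v, u} = s u {v, u}" by (simp add: opposite_def)
  then show "opposite s v {u, v} = s u {v, u}" by (simp add: insert_commute)
qed

text \<open>The caps are a separate argument instead of being read off a state, so that a partner's
  hypothetical matching can be expressed as a cap too.\<close>

definition gain :: "'v \<Rightarrow> 'v strategy \<Rightarrow> 'v strategy \<Rightarrow> real" where
  "gain v y c = (\<Sum>e\<in>incident G v. h e (min (y e) (c e)))"

lemma gain_cong:
  assumes "\<And>e. e \<in> incident G v \<Longrightarrow> min (y e) (c e) = min (y' e) (c' e)"
  shows "gain v y c = gain v y' c'"
  unfolding gain_def using assms by (intro sum.cong) auto

lemma utility_eq_gain:
  assumes "\<And>e. e \<in> incident G v \<Longrightarrow> 0 \<le> s v e"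
    and "\<And>e. e \<in> incident G v \<Longrightarrow> 0 \<le> c e"
    and "\<And>u. {v, u} \<in> links G \<Longrightarrow> c {v, u} = s u {v, u}"
  shows "utility G v s = gain v (s v) c"
proof -
  have "utility G v s = (\<Sum>u\<in>neighbors G v. h {v, u} (min (s v {v, u}) (c {v, u})))"
    unfolding utility_def
  proof (rule sum.cong)
    fix u assume "u \<in> neighbors G v"
    then have e: "{v, u} \<in> links G" by (simp add: neighbors_def)
    then have i: "{v, u} \<in> incident G v" by (simp add: incident_def)
    show "reward G {v, u} (s v {v, u}) (s u {v, u}) = h {v, u} (min (s v {v, u}) (c {v, u}))"
      using reward[OF e assms(1)[OF i] assms(2)[OF i]] assms(3)[OF e] by simp
  qed simp
  then show ?thesis
    unfolding gain_def using sum_neighbors[of "\<lambda>e. h e (min (s v e) (c e))" v] by simp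
qed

lemma strategies_nonneg: "y \<in> strategies G v \<Longrightarrow> e \<in> incident G v \<Longrightarrow> 0 \<le> y e"
  by (auto simp: strategies_def)

lemma strategies_le_budget:
  assumes "y \<in> strategies G v" "e \<in> incident G v"
  shows "y e \<le> budget G v"
proof -
  have "y e \<le> (\<Sum>f\<in>incident G v. y f)"
    by (rule member_le_sum) (use assms finite_incident strategies_nonneg in auto)
  then show ?thesis using assms(1) by (simp add: strategies_def)
qed

lemma strategies_decrease:
  assumes "y \<in> strategies G v" "0 \<le> a" "a \<le> y e"
  shows "y(e := a) \<in> strategies G v"
proof -
  have "(\<Sum>f\<in>incident G v. (y(e := a)) f) \<le> (\<Sum>f\<in>incident G v. y f)"
    using assms(3) by (intro sum_mono) auto
  then show ?thesis using assms by (auto simp: strategies_def)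
qed

lemma states_strategies: "s \<in> states G \<Longrightarrow> v \<in> players G \<Longrightarrow> s v \<in> strategies G v"
  by (simp add: states_def)

lemma states_update: "s \<in> states G \<Longrightarrow> y \<in> strategies G v \<Longrightarrow> s(v := y) \<in> states G"
  by (simp add: states_def)

lemma states_opposite:
  assumes "s \<in> states G" "e \<in> incident G v"
  shows "0 \<le> opposite s v e"
proof -
  obtain u where u: "e = {v, u}" "u \<noteq> v" "{v, u} \<in> links G" "u \<in> players G"
    using assms(2) by (rule incident_obtain)
  have "e \<in> incident G u" using u by (simp add: incident_def)
  then show ?thesis
    using strategies_nonneg[OF states_strategies[OF assms(1) u(4)]] u by (simp add: opposite_doubleton)
qed

lemma utility_state:
  assumes "s \<in> states G" "v \<in> players G"
  shows "utility G v s = gain v (s v) (opposite s v)"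
proof (rule utility_eq_gain)
  show "0 \<le> s v e" if "e \<in> incident G v" for e
    using strategies_nonneg[OF states_strategies[OF assms]] that .
  show "0 \<le> opposite s v e" if "e \<in> incident G v" for e
    using states_opposite[OF assms(1) that] .
  show "opposite s v {v, u} = s u {v, u}" if "{v, u} \<in> links G" for u
    using link_doubletonD[OF that] by (simp add: opposite_doubleton)
qed

lemma opposite_update_self:
  assumes "e \<in> incident G v"
  shows "opposite (s(v := y)) v e = opposite s v e"
  using assms by (elim incident_obtain) (simp add: opposite_doubleton)

lemma opposite_update_other:
  assumes "e \<in> incident G v" "u \<noteq> v"
  shows "opposite (s(u := y)) v e = (if e = {u, v} then y e else opposite s v e)"
  using assms by (elim incident_obtain) (auto simp: opposite_doubleton doubleton_eq_iff)

lemma utility_update: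
  assumes "s \<in> states G" "v \<in> players G" "y \<in> strategies G v"
  shows "utility G v (s(v := y)) = gain v y (opposite s v)"
proof -
  have "utility G v (s(v := y)) = gain v ((s(v := y)) v) (opposite (s(v := y)) v)"
    by (rule utility_state[OF states_update[OF assms(1,3)] assms(2)])
  also have "\<dots> = gain v y (opposite s v)"
    by (rule gain_cong) (simp add: opposite_update_self)
  finally show ?thesis .
qed

definition optimal :: "'v \<Rightarrow> 'v strategy \<Rightarrow> 'v strategy \<Rightarrow> bool" where
  "optimal v c y \<longleftrightarrow> y \<in> strategies G v \<and> (\<forall>z\<in>strategies G v. gain v z c \<le> gain v y c)"

lemma best_response_iff_optimal:
  assumes "s \<in> states G" "v \<in> players G"
  shows "best_response G s v y \<longleftrightarrow> optimal v (opposite s v) y"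
  unfolding best_response_def optimal_def by (auto simp: utility_update[OF assms])

text \<open>Matching makes the cap depend on the chosen strategy. No feasible strategy exceeds the
  budget of \<open>u\<close> on a link, so the constant cap \<open>budget G u\<close> has the same
  effect, and matched best responses become optima against fixed caps.\<close>

lemma utility_assuming_match:
  assumes s: "s \<in> states G" and uv: "{u, v} \<in> links G" and y: "y \<in> strategies G u"
  shows "utility G u (assuming_match s u v y) = gain u y ((opposite s u)({u, v} := budget G u))"
proof -
  note ne = link_doubletonD[OF uv]
  let ?c = "(opposite s u)({u, v} := y {u, v})"
  let ?s = "assuming_match s u v y"
  have su: "?s u = y" using ne by (simp add: assuming_match_def)
  have "utility G u ?s = gain u (?s u) ?c"
  proof (rule utility_eq_gain)
    show "0 \<le> ?s u e" if "e \<in> incident G u" for e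
      using strategies_nonneg[OF y that] su by simp
    show "0 \<le> ?c e" if "e \<in> incident G u" for e
      using strategies_nonneg[OF y that] states_opposite[OF s that] by auto
    show "?c {u, w} = ?s w {u, w}" if "{u, w} \<in> links G" for w
      using link_doubletonD[OF that] ne
      by (auto simp: assuming_match_def opposite_doubleton doubleton_eq_iff)
  qed
  also have "\<dots> = gain u y ((opposite s u)({u, v} := budget G u))"
    unfolding su using strategies_le_budget[OF y] by (intro gain_cong) (auto simp: min_absorb1)
  finally show ?thesis .
qed

lemma matched_best_response_iff_optimal:
  assumes "s \<in> states G" "{u, v} \<in> links G"
  shows "matched_best_response G s u v y \<longleftrightarrow>
    optimal u ((opposite s u)({u, v} := budget G u)) y"
  unfolding matched_best_response_def optimal_def by (auto simp: utility_assuming_match[OF assms])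

text \<open>Restricting \<open>v\<close> to at most \<open>p {u, v}\<close> costs nothing, since any
  excess can be cut down without changing its reward. Hence \<open>q\<close> is an unrestricted best
  response to the state in which \<open>u\<close> has already moved.\<close>

lemma recomputed_best_response:
  assumes s: "s \<in> states G" and uv: "{u, v} \<in> links G" and cand: "bilateral_candidate G s u v p q"
  shows "best_response G (s(u := p)) v q"
proof -
  note ne = link_doubletonD[OF uv]
  have p: "p \<in> strategies G u" and q: "q \<in> strategies G v"
    and opt: "\<And>y. y \<in> strategies G v \<Longrightarrow> y {u, v} \<le> p {u, v} \<Longrightarrow>
      utility G v (s(u := p, v := y)) \<le> utility G v (s(u := p, v := q))"
    using cand by (auto simp: bilateral_candidate_def matched_best_response_def)
  have st: "s(u := p) \<in> states G" using s p by (rule states_update)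
  have i: "{u, v} \<in> incident G u" "{u, v} \<in> incident G v" using uv by (auto simp: incident_def)
  have cap: "opposite (s(u := p)) v {u, v} = p {u, v}"
    using opposite_update_other[OF i(2) ne(1)] by simp
  have "utility G v (s(u := p, v := z)) \<le> utility G v (s(u := p, v := q))"
    if z: "z \<in> strategies G v" for z
  proof -
    let ?z = "z({u, v} := min (z {u, v}) (p {u, v}))"
    have z': "?z \<in> strategies G v"
      using strategies_nonneg[OF z i(2)] strategies_nonneg[OF p i(1)]
      by (intro strategies_decrease[OF z]) auto
    have "gain v z (opposite (s(u := p)) v) = gain v ?z (opposite (s(u := p)) v)"
      by (rule gain_cong) (auto simp: cap)
    then show ?thesis using opt[OF z'] utility_update[OF st ne(3)] z z' by simp
  qed
  then show ?thesis using q by (simp add: best_response_def)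
qed

lemma h_mono:
  assumes "e \<in> links G" "0 \<le> a" "a \<le> b"
  shows "h e a \<le> h e b"
proof (cases "a = b")
  case False
  then have "0 < d e b * (b - a)" using pos[OF assms(1), of b] assms by simp
  then show ?thesis using tangent_boundsD(1)[OF tangent[OF assms(1)], of a b] assms False by simp
qed simp

lemma gain_mono:
  assumes "\<And>e. e \<in> incident G v \<Longrightarrow> 0 \<le> min (y e) (c e)"
    and "\<And>e. e \<in> incident G v \<Longrightarrow> min (y e) (c e) \<le> min (y' e) (c' e)"
  shows "gain v y c \<le> gain v y' c'"
  unfolding gain_def using assms by (intro sum_mono h_mono) (auto simp: incident_def)

end

section \<open>Securing the targets\<close>

locale profiled_game = min_effort_game G h d
  for G :: "'v contribution_game" and h d :: "'v edge \<Rightarrow> real \<Rightarrow> real" +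
  fixes x :: "'v edge \<Rightarrow> real" and r :: "'v \<Rightarrow> nat"
  assumes profile: "ranked_profile d (links G) (players G) (budget G) x r"
begin

lemma x_nonneg: "e \<in> links G \<Longrightarrow> 0 \<le> x e"
  using profile by (simp add: ranked_profile_def)

lemma x_strategy: "v \<in> players G \<Longrightarrow> x \<in> strategies G v"
  using profile by (auto simp: ranked_profile_def strategies_def incident_def)

lemma r_neq: "{u, w} \<in> links G \<Longrightarrow> r u \<noteq> r w"
  using profile by (simp add: ranked_profile_def)

lemma level_le:
  assumes "e \<in> links G" "f \<in> links G" "edge_rank r e \<le> edge_rank r f" "0 < x e"
  shows "d f (x f) \<le> d e (x e)"
  using profile assms by (simp add: ranked_profile_def)

lemma owner_budget:
  assumes "{u, w} \<in> links G" "r u < r w"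
  shows "(\<Sum>e\<in>incident G u. x e) = budget G u"
  using profile assms unfolding ranked_profile_def incident_def by blast

lemma edge_rank_le: "e \<in> incident G v \<Longrightarrow> edge_rank r e \<le> r v"
  by (elim incident_obtain) auto

text \<open>Lower bounds that already sum to the whole budget must be tight. The link to
  \<open>w\<close> certifies that \<open>u\<close> owns some link, so that its targets exhaust its
  budget.\<close>

lemma owner_exact:
  assumes "{u, w} \<in> links G" "r u < r w" and y: "y \<in> strategies G u"
    and ge: "\<And>e. e \<in> incident G u \<Longrightarrow> x e \<le> y e" and e: "e \<in> incident G u"
  shows "y e = x e"
proof (rule ccontr)
  assume "y e \<noteq> x e"
  then have "x e < y e" using ge[OF e] by simp
  then have "(\<Sum>e\<in>incident G u. x e) < (\<Sum>e\<in>incident G u. y e)"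
    using ge e finite_incident by (intro sum_strict_mono_ex1) auto
  also have "\<dots> \<le> budget G u" using y by (simp add: strategies_def)
  finally show False using owner_budget[OF assms(1,2)] by simp
qed

text \<open>Links of rank below \<open>k\<close> owned by a neighbor are capped at their target, so budget missing on
  \<open>e\<close> can only have gone to links of at least the same rank, whose marginal reward at the target
  is no larger.\<close>

lemma optimal_ge:
  assumes v: "v \<in> players G" and opt: "optimal v c y"
    and c: "\<And>e. e \<in> incident G v \<Longrightarrow> 0 \<le> c e"
    and settled: "\<And>e. e \<in> incident G v \<Longrightarrow> edge_rank r e < k \<Longrightarrow> edge_rank r e < r v \<Longrightarrow> c e = x e"
    and e: "e \<in> incident G v" "edge_rank r e \<le> k" "x e \<le> c e"
  shows "x e \<le> y e"
proof (rule capped_optimum_ge[where h = h and d = d and S = "incident G v" and c = c and B = "budget G v"])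
  have y: "y \<in> strategies G v"
    and max: "\<And>z. z \<in> strategies G v \<Longrightarrow> gain v z c \<le> gain v y c"
    using opt by (auto simp: optimal_def)
  show "y \<in> incident G v \<rightarrow> {0..}" "(\<Sum>e\<in>incident G v. y e) \<le> budget G v"
    using y by (auto simp: strategies_def)
  show "(\<Sum>e\<in>incident G v. h e (min (z e) (c e))) \<le> (\<Sum>e\<in>incident G v. h e (min (y e) (c e)))"
    if "z \<in> incident G v \<rightarrow> {0..}" "(\<Sum>e\<in>incident G v. z e) \<le> budget G v" for z
    using max[of z] that by (simp add: strategies_def gain_def)
  show "(\<Sum>e\<in>incident G v. x e) \<le> budget G v"
    using x_strategy[OF v] by (simp add: strategies_def)
  show "d f (x f) \<le> d e (x e)" if f: "f \<in> incident G v" "x f < c f" "0 < x e" for f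
  proof -
    have "edge_rank r e \<le> edge_rank r f"
    proof (rule ccontr)
      assume "\<not> ?thesis"
      then have "c f = x f"
        using settled[OF f(1)] e(2) edge_rank_le[OF e(1)] by linarith
      then show False using f(2) by simp
    qed
    then show ?thesis using level_le f e(1) by (simp add: incident_def)
  qed
qed (use finite_incident tangent pos c x_nonneg e in \<open>auto simp: incident_def\<close>)

section \<open>Lower bounds preserved by best responses\<close>

definition secured :: "'v state \<Rightarrow> 'v edge \<Rightarrow> bool" where
  "secured s e \<longleftrightarrow> (\<forall>w\<in>e. x e \<le> s w e)"

definition secured_below :: "'v state \<Rightarrow> nat \<Rightarrow> bool" where
  "secured_below s k \<longleftrightarrow> (\<forall>e\<in>links G. edge_rank r e < k \<longrightarrow> secured s e)"

lemma secured_opposite: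
  assumes "secured s e" "e \<in> incident G v"
  shows "x e \<le> opposite s v e"
  using assms(2,1) by (elim incident_obtain) (simp add: opposite_doubleton secured_def)

text \<open>The hypothesis \<open>edge_rank r e < r v\<close> says that the other endpoint owns the
  link. All links of that owner have at most its rank, which is below \<open>k\<close>; so they are
  secured, and \<open>owner_exact\<close> fixes its contributions.\<close>

lemma settled_opposite:
  assumes s: "s \<in> states G" "secured_below s k"
    and e: "e \<in> incident G v" "edge_rank r e < k" "edge_rank r e < r v"
  shows "opposite s v e = x e"
proof -
  obtain u where u: "e = {v, u}" "u \<noteq> v" "{v, u} \<in> links G" "u \<in> players G"
    using e(1) by (rule incident_obtain)
  have r: "r u < r v" "edge_rank r e = r u" using e(3) u(1) by auto
  have link: "{u, v} \<in> links G" using u(3) by (simp add: insert_commute)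
  have "s u e = x e"
  proof (rule owner_exact[OF link r(1) states_strategies[OF s(1) u(4)]])
    show "x f \<le> s u f" if f: "f \<in> incident G u" for f
    proof -
      have "edge_rank r f < k" using edge_rank_le[OF f] e(2) r(2) by simp
      then show ?thesis using s(2) f by (auto simp: secured_below_def secured_def incident_def)
    qed
    show "e \<in> incident G u" using link u(1) by (simp add: incident_def insert_commute)
  qed
  then show ?thesis using u by (simp add: opposite_doubleton)
qed

lemma best_response_ge:
  assumes s: "s \<in> states G" "secured_below s k" and v: "v \<in> players G"
    and y: "best_response G s v y"
    and e: "e \<in> incident G v" "edge_rank r e \<le> k" "x e \<le> opposite s v e"
  shows "x e \<le> y e"
proof (rule optimal_ge[OF v])
  show "optimal v (opposite s v) y" using y best_response_iff_optimal[OF s(1) v] by simp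
qed (use states_opposite[OF s(1)] settled_opposite[OF s] e in auto)

text \<open>Assuming a match replaces the cap on the common link by one that never binds. This would
  destroy a settled cap if the partner owned the link; \<open>lead\<close> excludes that
  case.\<close>

lemma matched_best_response_ge:
  assumes s: "s \<in> states G" "secured_below s k" and uv: "{u, v} \<in> links G"
    and y: "matched_best_response G s u v y"
    and lead: "edge_rank r {u, v} < k \<Longrightarrow> r u < r v"
    and e: "e \<in> incident G u" "edge_rank r e \<le> k" "e = {u, v} \<or> x e \<le> opposite s u e"
  shows "x e \<le> y e"
proof -
  note ne = link_doubletonD[OF uv]
  let ?c = "(opposite s u)({u, v} := budget G u)"
  have i: "{u, v} \<in> incident G u" using uv by (simp add: incident_def)
  have b: "x {u, v} \<le> budget G u" by (rule strategies_le_budget[OF x_strategy[OF ne(2)] i])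
  show ?thesis
  proof (rule optimal_ge[OF ne(2)])
    show "optimal u ?c y" using y matched_best_response_iff_optimal[OF s(1) uv] by simp
    show "0 \<le> ?c f" if "f \<in> incident G u" for f
      using states_opposite[OF s(1) that] b x_nonneg[OF uv] by simp
    show "?c f = x f" if f: "f \<in> incident G u" "edge_rank r f < k" "edge_rank r f < r u" for f
    proof -
      have "f \<noteq> {u, v}" using f lead by auto
      then show ?thesis using settled_opposite[OF s f] by simp
    qed
    show "x e \<le> ?c e" using e(3) b by auto
  qed (use e in auto)
qed

text \<open>If the common link is owned by the partner of \<open>u\<close>, then \<open>u\<close> may ask for more than the
  target on it; but the partner asks for exactly the target, and the smaller ask counts.\<close>

lemma candidate_fixed_ge:
  assumes s: "s \<in> states G" "secured_below s k" and uv: "{u, v} \<in> links G"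
    and cand: "bilateral_candidate G s u v p q"
    and e: "e \<in> incident G u" "edge_rank r e \<le> k" "e = {u, v} \<or> x e \<le> opposite s u e"
  shows "x e \<le> p e"
proof -
  note ne = link_doubletonD[OF uv]
  have p: "matched_best_response G s u v p" using cand by (simp add: bilateral_candidate_def)
  then have p_strat: "p \<in> strategies G u" by (simp add: matched_best_response_def)
  have i: "{u, v} \<in> incident G u" using uv by (simp add: incident_def)
  show ?thesis
  proof (cases "edge_rank r {u, v} < k \<and> r v < r u")
    case False
    then show ?thesis using matched_best_response_ge[OF s uv p _ e] r_neq[OF uv] by force
  next
    case True
    have vu: "{v, u} \<in> links G" using uv by (simp add: insert_commute)
    obtain z where z: "matched_best_response G s v u z" "p {u, v} \<le> z {u, v}"
      using cand by (auto simp: bilateral_candidate_def)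
    have "z {u, v} = x {u, v}"
    proof (rule owner_exact[OF vu])
      show "r v < r u" using True by simp
      show "z \<in> strategies G v" using z(1) by (simp add: matched_best_response_def)
      show "x f \<le> z f" if f: "f \<in> incident G v" for f
      proof (rule matched_best_response_ge[OF s vu z(1)])
        have "edge_rank r f < k" using edge_rank_le[OF f] True by auto
        then show "edge_rank r f \<le> k" "f = {v, u} \<or> x f \<le> opposite s v f"
          using secured_opposite[OF _ f, of s] s(2) f by (auto simp: secured_below_def incident_def)
      qed (use True f in auto)
    qed (use uv in \<open>simp add: incident_def\<close>)
    then have p_le: "p {u, v} \<le> x {u, v}" using z(2) by simp
    let ?c = "(opposite s u)({u, v} := budget G u)"
    let ?x = "(opposite s u)({u, v} := x {u, v})"
    have b: "x {u, v} \<le> budget G u" by (rule strategies_le_budget[OF x_strategy[OF ne(2)] i])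
    have opt: "optimal u ?c p" using p matched_best_response_iff_optimal[OF s(1) uv] by simp
    \<comment> \<open>As \<open>p\<close> asks for at most the target on the common link, lowering
      the cap there to the target leaves its gain unchanged and can only reduce that of competitors.
      So \<open>p\<close> is also optimal against caps that respect all settled links.\<close>
    have "optimal u ?x p"
      unfolding optimal_def
    proof (intro conjI ballI p_strat)
      fix y assume y: "y \<in> strategies G u"
      have "gain u y ?x \<le> gain u y ?c"
      proof (rule gain_mono)
        fix f assume f: "f \<in> incident G u"
        show "0 \<le> min (y f) (?x f)"
          using strategies_nonneg[OF y f] states_opposite[OF s(1) f] x_nonneg[OF uv] by simp
        show "min (y f) (?x f) \<le> min (y f) (?c f)" using b by auto
      qed
      also have "\<dots> \<le> gain u p ?c" using opt y by (simp add: optimal_def)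
      also have "\<dots> = gain u p ?x" using p_le b by (intro gain_cong) auto
      finally show "gain u y ?x \<le> gain u p ?x" .
    qed
    then show ?thesis
    proof (rule optimal_ge[OF ne(2)])
      show "0 \<le> ?x f" if "f \<in> incident G u" for f
        using states_opposite[OF s(1) that] x_nonneg[OF uv] by simp
      show "?x f = x f" if "f \<in> incident G u" "edge_rank r f < k" "edge_rank r f < r u" for f
        using settled_opposite[OF s that] by simp
      show "x e \<le> ?x e" using e(3) by auto
    qed (use e in auto)
  qed
qed

text \<open>The recomputation of \<open>v\<close> takes place after \<open>u\<close> is fixed, so
  the invariant is needed in this intermediate state as well.\<close>

lemma secured_below_update_fixed:
  assumes s: "s \<in> states G" "secured_below s k" and uv: "{u, v} \<in> links G"
    and cand: "bilateral_candidate G s u v p q"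
  shows "secured_below (s(u := p)) k"
  unfolding secured_below_def secured_def
proof (intro ballI impI)
  fix e w assume e: "e \<in> links G" "edge_rank r e < k" and w: "w \<in> e"
  have sec: "secured s e" using s(2) e by (simp add: secured_below_def)
  show "x e \<le> (s(u := p)) w e"
  proof (cases "w = u")
    case True
    then have i: "e \<in> incident G u" using e w by (simp add: incident_def)
    have "x e \<le> p e"
      by (rule candidate_fixed_ge[OF s uv cand i]) (use e secured_opposite[OF sec i] in auto)
    then show ?thesis using True by simp
  next
    case False
    then show ?thesis using sec w by (simp add: secured_def)
  qed
qed

text \<open>After its move \<open>u\<close> offers at least the target on the common link, so the
  bound for best responses covers that link too. An arbitrary best response \<open>y\<close> is
  allowed because the bound is applied both to the actual \<open>q\<close> and, to obtain strict
  profit, to the lowered old strategy of \<open>v\<close>.\<close>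

lemma recomputed_ge:
  assumes s: "s \<in> states G" "secured_below s k" and uv: "{u, v} \<in> links G"
    and cand: "bilateral_candidate G s u v p q" and y: "best_response G (s(u := p)) v y"
    and rank: "edge_rank r {u, v} \<le> k"
    and e: "e \<in> incident G v" "edge_rank r e \<le> k" "e = {u, v} \<or> x e \<le> opposite s v e"
  shows "x e \<le> y e"
proof (rule best_response_ge[OF _ secured_below_update_fixed[OF s uv cand] _ y e(1,2)])
  note ne = link_doubletonD[OF uv]
  have p: "p \<in> strategies G u"
    using cand by (simp add: bilateral_candidate_def matched_best_response_def)
  show "s(u := p) \<in> states G" using s(1) p by (rule states_update)
  show "v \<in> players G" by (rule ne(3))
  have "x {u, v} \<le> p {u, v}"
    by (rule candidate_fixed_ge[OF s uv cand _ rank]) (use uv in \<open>auto simp: incident_def\<close>)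
  then show "x e \<le> opposite (s(u := p)) v e"
    using e(3) opposite_update_other[OF e(1) ne(1)] by auto
qed

lemma candidate_ge:
  assumes s: "s \<in> states G" "secured_below s k" and uv: "{u, v} \<in> links G"
    and cand: "bilateral_candidate G s u v p q"
    and e: "e \<in> links G" "edge_rank r e \<le> k" "e = {u, v} \<or> secured s e"
  shows "u \<in> e \<Longrightarrow> x e \<le> p e" "v \<in> e \<Longrightarrow> x e \<le> q e"
proof -
  have opp: "e = {u, v} \<or> x e \<le> opposite s w e" if "e \<in> incident G w" for w
    using e(3) secured_opposite[OF _ that] by blast
  show "x e \<le> p e" if "u \<in> e"
  proof -
    have i: "e \<in> incident G u" using e(1) that by (simp add: incident_def)
    show ?thesis by (rule candidate_fixed_ge[OF s uv cand i e(2) opp[OF i]])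
  qed
  show "x e \<le> q e" if "v \<in> e"
  proof -
    have i: "e \<in> incident G v" using e(1) that by (simp add: incident_def)
    note q = recomputed_best_response[OF s(1) uv cand]
    show ?thesis
    proof (cases "edge_rank r {u, v} \<le> k")
      case True
      show ?thesis by (rule recomputed_ge[OF s uv cand q True i e(2) opp[OF i]])
    next
      \<comment> \<open>Nothing is known here about \<open>p\<close> on the common link; but
        \<open>e\<close> is a different link, on which \<open>v\<close> faces the same cap as
        before.\<close>
      case False
      then have ne: "e \<noteq> {u, v}" using e(2) by auto
      show ?thesis
      proof (rule best_response_ge[OF _ secured_below_update_fixed[OF s uv cand] _ q i e(2)])
        show "s(u := p) \<in> states G"
          using s(1) cand by (intro states_update) (auto simp: bilateral_candidate_def matched_best_response_def)
        show "v \<in> players G" by (rule link_doubletonD[OF uv])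
        show "x e \<le> opposite (s(u := p)) v e"
          using opp[OF i] ne opposite_update_other[OF i link_doubletonD(1)[OF uv]] by simp
      qed
    qed
  qed
qed

text \<open>Since \<open>q\<close> matches \<open>p\<close> on the common link, the assumption of
  \<open>u\<close> comes true and its utility is exactly the gain it optimized.\<close>

lemma candidate_utilities:
  assumes s: "s \<in> states G" and uv: "{u, v} \<in> links G"
    and cand: "bilateral_candidate G s u v p q"
  shows "utility G u (s(u := p, v := q)) = gain u p ((opposite s u)({u, v} := budget G u))"
    and "utility G v (s(u := p, v := q)) = gain v q (opposite (s(u := p)) v)"
proof -
  note ne = link_doubletonD[OF uv]
  have p: "p \<in> strategies G u" and q: "q \<in> strategies G v" and eq: "q {u, v} = p {u, v}"
    using cand by (auto simp: bilateral_candidate_def matched_best_response_def)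
  have st: "s(u := p) \<in> states G" using s p by (rule states_update)
  show "utility G v (s(u := p, v := q)) = gain v q (opposite (s(u := p)) v)"
    by (rule utility_update[OF st ne(3) q])
  have "s(u := p, v := q) = (s(v := q))(u := p)" using ne(1) by (simp add: fun_upd_twist)
  then have "utility G u (s(u := p, v := q)) = gain u p (opposite (s(v := q)) u)"
    using utility_update[OF states_update[OF s q] ne(2) p] by simp
  also have "\<dots> = gain u p ((opposite s u)({u, v} := budget G u))"
  proof (rule gain_cong)
    fix e assume e: "e \<in> incident G u"
    show "min (p e) (opposite (s(v := q)) u e) = min (p e) (((opposite s u)({u, v} := budget G u)) e)"
      using opposite_update_other[OF e, of v s q] ne(1) eq strategies_le_budget[OF p e]
      by (auto simp: insert_commute)
  qed
  finally show "utility G u (s(u := p, v := q)) = gain u p ((opposite s u)({u, v} := budget G u))" .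
qed

text \<open>The move on an unsecured link is strictly better for both players, since lowering the current
  contributions to the smaller one costs nothing and no best response stays below the target.\<close>

lemma candidate_profitable:
  assumes s: "s \<in> states G" "secured_below s (edge_rank r {u, v})" and uv: "{u, v} \<in> links G"
    and cand: "bilateral_candidate G s u v p q" and ns: "\<not> secured s {u, v}"
  shows "profitable_bilateral_deviation G s u v p q"
proof -
  note ne = link_doubletonD[OF uv]
  have p: "p \<in> strategies G u" and q: "q \<in> strategies G v" and pm: "matched_best_response G s u v p"
    using cand by (auto simp: bilateral_candidate_def matched_best_response_def)
  have i: "{u, v} \<in> incident G u" "{u, v} \<in> incident G v" using uv by (auto simp: incident_def)
  define z where "z = min (s u {u, v}) (s v {u, v})"
  note su = states_strategies[OF s(1) ne(2)] and sv = states_strategies[OF s(1) ne(3)]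
  have z: "0 \<le> z" "z < x {u, v}"
    using ns strategies_nonneg[OF su i(1)] strategies_nonneg[OF sv i(2)]
    by (auto simp: z_def secured_def)
  have zu: "(s u)({u, v} := z) \<in> strategies G u" and zv: "(s v)({u, v} := z) \<in> strategies G v"
    using su sv z(1) by (auto intro!: strategies_decrease simp: z_def)
  have pge: "x {u, v} \<le> p {u, v}"
    using candidate_ge(1)[OF s uv cand uv] by simp
  have b: "x {u, v} \<le> budget G u" by (rule strategies_le_budget[OF x_strategy[OF ne(2)] i(1)])
  let ?c = "(opposite s u)({u, v} := budget G u)"
  have "utility G u s = gain u ((s u)({u, v} := z)) ?c"
    unfolding utility_state[OF s(1) ne(2)]
    by (rule gain_cong) (use z b opposite_doubleton[of v u s] ne(1) in \<open>auto simp: z_def\<close>)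
  moreover have "gain u ((s u)({u, v} := z)) ?c < gain u p ?c"
  proof (rule ccontr)
    assume ge: "\<not> ?thesis"
    have opt: "optimal u ?c p" using pm matched_best_response_iff_optimal[OF s(1) uv] by simp
    then have "optimal u ?c ((s u)({u, v} := z))"
      using ge zu by (auto simp: optimal_def intro: order_trans)
    then have m: "matched_best_response G s u v ((s u)({u, v} := z))"
      using matched_best_response_iff_optimal[OF s(1) uv] by simp
    have "x {u, v} \<le> ((s u)({u, v} := z)) {u, v}"
      by (rule matched_best_response_ge[OF s uv m]) (use i in auto)
    then show False using z(2) by simp
  qed
  moreover have "utility G v s = gain v ((s v)({u, v} := z)) (opposite (s(u := p)) v)"
    unfolding utility_state[OF s(1) ne(3)]
  proof (rule gain_cong)
    fix e assume e: "e \<in> incident G v"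
    show "min (s v e) (opposite s v e) = min (((s v)({u, v} := z)) e) (opposite (s(u := p)) v e)"
      using opposite_update_other[OF e ne(1)] z pge opposite_doubleton(2)[OF ne(1)]
      by (auto simp: z_def min.commute)
  qed
  moreover have "gain v ((s v)({u, v} := z)) (opposite (s(u := p)) v) < gain v q (opposite (s(u := p)) v)"
  proof (rule ccontr)
    assume ge: "\<not> ?thesis"
    note br = best_response_iff_optimal[OF states_update[OF s(1) p] ne(3)]
    have "optimal v (opposite (s(u := p)) v) q"
      using recomputed_best_response[OF s(1) uv cand] br by simp
    then have "optimal v (opposite (s(u := p)) v) ((s v)({u, v} := z))"
      using ge zv by (auto simp: optimal_def intro: order_trans)
    then have m: "best_response G (s(u := p)) v ((s v)({u, v} := z))" using br by simp
    have "x {u, v} \<le> ((s v)({u, v} := z)) {u, v}"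
      by (rule recomputed_ge[OF s uv cand m]) (use i in auto)
    then show False using z(2) by simp
  qed
  ultimately show ?thesis
    using p q candidate_utilities[OF s(1) uv cand]
    by (simp add: profitable_bilateral_deviation_def)
qed

section \<open>One round of simultaneous moves\<close>

lemma bilateral_move_strategies:
  assumes s: "s \<in> states G" and uv: "e0 \<in> links G"
    and move: "bilateral_move G e0 s s'" and w: "w \<in> e0"
  shows "s' w \<in> strategies G w"
proof -
  obtain u v p q where m: "e0 = {u, v}" "bilateral_candidate G s u v p q"
    "if profitable_bilateral_deviation G s u v p q
     then s' u = p \<and> s' v = q else s' u = s u \<and> s' v = s v"
    using move unfolding bilateral_move_def by blast
  have "p \<in> strategies G u" "q \<in> strategies G v"
    using m(2) by (auto simp: bilateral_candidate_def matched_best_response_def)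
  moreover have "w \<in> players G" using link_props[OF uv] w by blast
  then have "s w \<in> strategies G w" using s by (simp add: states_def)
  ultimately show ?thesis using m(1,3) w by (auto split: if_splits)
qed

text \<open>A rejected candidate leaves the old strategies in place. An unsecured common link of
  rank at most \<open>k\<close> would have made it profitable by
  \<open>candidate_profitable\<close>, so \<open>e\<close> was secured already.\<close>

lemma bilateral_move_ge:
  assumes s: "s \<in> states G" "secured_below s k" and e0: "e0 \<in> links G"
    and move: "bilateral_move G e0 s s'" and w: "w \<in> e0"
    and e: "e \<in> links G" "edge_rank r e \<le> k" "e = e0 \<or> secured s e" "w \<in> e"
  shows "x e \<le> s' w e"
proof -
  obtain u v p q where m: "e0 = {u, v}" "bilateral_candidate G s u v p q"
    "if profitable_bilateral_deviation G s u v p q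
     then s' u = p \<and> s' v = q else s' u = s u \<and> s' v = s v"
    using move unfolding bilateral_move_def by blast
  have uv: "{u, v} \<in> links G" using e0 m(1) by simp
  have e': "e = {u, v} \<or> secured s e" using e(3) m(1) by simp
  note ge = candidate_ge[OF s uv m(2) e(1,2) e']
  show ?thesis
  proof (cases "profitable_bilateral_deviation G s u v p q")
    case True
    then have "s' u = p" "s' v = q" using m(3) by auto
    then show ?thesis using ge w e(4) m(1) by auto
  next
    case False
    then have eq: "s' u = s u" "s' v = s v" using m(3) by auto
    have "secured s e"
    proof (rule ccontr)
      assume ns: "\<not> secured s e"
      then have [simp]: "e = {u, v}" using e' by blast
      have "secured_below s (edge_rank r {u, v})" using s(2) e(2) by (auto simp: secured_below_def)
      then show False using candidate_profitable[OF s(1) _ uv m(2)] ns False by simp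
    qed
    then show ?thesis using eq w e(4) m(1) by (auto simp: secured_def)
  qed
qed

lemma round_cases:
  assumes "br_round G (I, P) s s'" "v \<in> players G"
  obtains "v \<in> I" "best_response G s v (s' v)"
    | e where "e \<in> P" "v \<in> e" "bilateral_move G e s s'"
    | "s' v = s v"
proof -
  have "\<forall>v\<in>I. best_response G s v (s' v)" "\<forall>e\<in>P. bilateral_move G e s s'"
    "\<forall>v\<in>players G - (I \<union> \<Union>P). s' v = s v"
    using assms(1) by (simp_all add: br_round_def)
  then show ?thesis using that assms(2) by blast
qed

lemma round_states:
  assumes s: "s \<in> states G" and P: "P \<subseteq> links G" and round: "br_round G (I, P) s s'"
  shows "s' \<in> states G"
  unfolding states_def
proof (intro CollectI ballI)
  fix v assume v: "v \<in> players G"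
  from round v show "s' v \<in> strategies G v"
  proof (cases rule: round_cases)
    case 1
    then show ?thesis by (simp add: best_response_def)
  next
    case (2 e)
    then show ?thesis using bilateral_move_strategies[OF s] P by blast
  next
    case 3
    then show ?thesis using states_strategies[OF s v] by simp
  qed
qed

text \<open>All movers react to the same \<open>s\<close>, and the bound concerns each endpoint's
  own strategy, so endpoints are treated one at a time, whatever the other players do. The
  disjunction covers both securing a link and keeping it secured.\<close>

lemma round_secured:
  assumes s: "s \<in> states G" "secured_below s k" and P: "P \<subseteq> links G"
    and round: "br_round G (I, P) s s'"
    and e: "e \<in> links G" "edge_rank r e \<le> k" "e \<in> P \<or> secured s e"
  shows "secured s' e"
  unfolding secured_def
proof
  fix w assume w: "w \<in> e"
  then have wp: "w \<in> players G" and i: "e \<in> incident G w"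
    using link_props[OF e(1)] e(1) by (auto simp: incident_def)
  show "x e \<le> s' w e"
  proof (cases "e \<in> P")
    case True
    then have "bilateral_move G e s s'" using round by (simp add: br_round_def)
    then show ?thesis using bilateral_move_ge[OF s e(1) _ w e(1,2) _ w] by blast
  next
    case False
    then have sec: "secured s e" using e(3) by simp
    from round wp show ?thesis
    proof (cases rule: round_cases)
      case 1
      show ?thesis
        by (rule best_response_ge[OF s wp 1(2) i e(2)]) (rule secured_opposite[OF sec i])
    next
      case (2 e0)
      then have "e0 \<in> links G" using P by blast
      then show ?thesis using bilateral_move_ge[OF s _ 2(3,2) e(1,2) _ w] sec by blast
    next
      case 3
      then show ?thesis using sec w by (simp add: secured_def)
    qed
  qed
qed

section \<open>States with all links secured\<close>

definition all_secured :: "'v state \<Rightarrow> bool" where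
  "all_secured s \<longleftrightarrow> (\<forall>e\<in>links G. secured s e)"

lemma all_secured_below: "all_secured s \<Longrightarrow> secured_below s k"
  by (simp add: all_secured_def secured_below_def)

lemma secured_owner:
  assumes s: "s \<in> states G" "all_secured s" and uw: "{u, w} \<in> links G" "r u < r w"
    and e: "e \<in> incident G u"
  shows "s u e = x e"
proof (rule owner_exact[OF uw _ _ e])
  show "s u \<in> strategies G u" using states_strategies[OF s(1) link_doubletonD(2)[OF uw(1)]] .
  show "x f \<le> s u f" if "f \<in> incident G u" for f
    using s(2) that by (auto simp: all_secured_def secured_def incident_def)
qed

text \<open>One endpoint owns the link and contributes exactly the target, while the other
  contributes at least that.\<close>

lemma secured_min:
  assumes s: "s \<in> states G" "all_secured s" and e: "e \<in> incident G v"
  shows "min (s v e) (opposite s v e) = x e"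
proof -
  obtain u where u: "e = {v, u}" "u \<noteq> v" "{v, u} \<in> links G"
    using e by (rule incident_obtain)
  have sec: "x e \<le> s v e" "x e \<le> s u e"
    using s(2) u by (auto simp: all_secured_def secured_def)
  have uv: "{u, v} \<in> links G" and i: "e \<in> incident G u"
    using u by (auto simp: insert_commute incident_def)
  have "s v e = x e \<or> s u e = x e"
  proof (cases "r v < r u")
    case True
    then show ?thesis using secured_owner[OF s u(3) _ e] by simp
  next
    case False
    then have "r u < r v" using r_neq[OF u(3)] by simp
    then show ?thesis using secured_owner[OF s uv _ i] by simp
  qed
  then show ?thesis using sec u by (auto simp: opposite_doubleton)
qed

lemma secured_effective:
  assumes "s \<in> states G" "all_secured s" "e \<in> incident G v"
  shows "effective s v e = x e"
proof -
  obtain u where "e = {v, u}" "u \<noteq> v" using assms(3) by (rule incident_obtain)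
  then show ?thesis using secured_min[OF assms] by (simp add: effective_def opposite_doubleton)
qed

text \<open>The owner of the common link is the player that cannot gain: its part of the candidate
  again equals the targets, so its utility is unchanged. From then on a bilateral chance alters
  neither strategy of the pair.\<close>

lemma secured_not_profitable:
  assumes s: "s \<in> states G" "all_secured s" and uv: "{u, v} \<in> links G"
    and cand: "bilateral_candidate G s u v p q"
  shows "\<not> profitable_bilateral_deviation G s u v p q"
proof -
  note ne = link_doubletonD[OF uv]
  have below: "secured_below s k" for k using s(2) by (rule all_secured_below)
  have p: "p \<in> strategies G u" and q: "q \<in> strategies G v"
    using cand by (auto simp: bilateral_candidate_def matched_best_response_def)
  have ge: "e \<in> incident G u \<Longrightarrow> x e \<le> p e" "e \<in> incident G v \<Longrightarrow> x e \<le> q e" for e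
    using candidate_ge[OF s(1) below uv cand, of e "edge_rank r e"] s(2)
    by (auto simp: incident_def all_secured_def)
  have util: "utility G w s = gain w x x" if "w \<in> players G" for w
    unfolding utility_state[OF s(1) that] using secured_min[OF s] by (intro gain_cong) simp
  show ?thesis
  proof (cases "r u < r v")
    case True
    have b: "x {u, v} \<le> budget G u"
      using strategies_le_budget[OF x_strategy[OF ne(2)]] uv by (simp add: incident_def)
    have "utility G u (s(u := p, v := q)) = gain u x x"
      unfolding candidate_utilities(1)[OF s(1) uv cand]
    proof (rule gain_cong)
      fix e assume e: "e \<in> incident G u"
      have "p e = x e" by (rule owner_exact[OF uv True p ge(1) e])
      moreover have "x e \<le> opposite s u e"
        using s(2) e by (intro secured_opposite) (auto simp: all_secured_def incident_def)
      ultimately show "min (p e) (((opposite s u)({u, v} := budget G u)) e) = min (x e) (x e)"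
        using b by auto
    qed
    then show ?thesis using util[OF ne(2)] by (simp add: profitable_bilateral_deviation_def)
  next
    case False
    then have vu: "{v, u} \<in> links G" "r v < r u" using r_neq[OF uv] uv by (auto simp: insert_commute)
    have "utility G v (s(u := p, v := q)) = gain v x x"
      unfolding candidate_utilities(2)[OF s(1) uv cand]
    proof (rule gain_cong)
      fix e assume e: "e \<in> incident G v"
      have "q e = x e" by (rule owner_exact[OF vu q ge(2) e])
      moreover have "secured (s(u := p)) e"
        using secured_below_update_fixed[OF s(1) below uv cand, of "Suc (edge_rank r e)"] e
        by (simp add: secured_below_def incident_def)
      then have "x e \<le> opposite (s(u := p)) v e" using e by (rule secured_opposite)
      ultimately show "min (q e) (opposite (s(u := p)) v e) = min (x e) (x e)" by simp
    qed
    then show ?thesis using util[OF ne(3)] by (simp add: profitable_bilateral_deviation_def)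
  qed
qed

text \<open>On links owned by \<open>v\<close> the budget leaves no room for surplus. On the others
  the owner offers exactly the target in the old state, and frugality bounds \<open>v\<close> by
  that offer.\<close>

lemma frugal_response_exact:
  assumes s: "s \<in> states G" "all_secured s" and s': "s' \<in> states G" "all_secured s'"
    and frugal: "\<And>u. u \<in> neighbors G v \<Longrightarrow> s' v {v, u} \<le> s u {v, u}"
    and e: "e \<in> incident G v"
  shows "s' v e = x e"
proof -
  obtain u where u: "e = {v, u}" "u \<noteq> v" "{v, u} \<in> links G"
    using e by (rule incident_obtain)
  have uv: "{u, v} \<in> links G" and i: "e \<in> incident G u"
    using u by (auto simp: insert_commute incident_def)
  show ?thesis
  proof (cases "r v < r u")
    case True
    then show ?thesis using secured_owner[OF s' u(3) _ e] by simp
  next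
    case False
    then have "r u < r v" using r_neq[OF u(3)] by simp
    then have "s u e = x e" using secured_owner[OF s uv _ i] by simp
    then have "s' v e \<le> x e" using frugal[of u] u by (simp add: neighbors_def)
    moreover have "x e \<le> s' v e" using s'(2) u by (auto simp: all_secured_def secured_def)
    ultimately show ?thesis by simp
  qed
qed

section \<open>The target profile is a pairwise equilibrium\<close>

lemma tangent_le:
  assumes "e \<in> links G" "0 \<le> a" "0 \<le> b"
  shows "h e b - h e a \<le> d e a * (b - a)"
proof (cases a b rule: linorder_cases)
  case less
  then show ?thesis using tangent_boundsD(2)[OF tangent[OF assms(1)], of a b] assms by simp
next
  case greater
  then show ?thesis
    using tangent_boundsD(1)[OF tangent[OF assms(1)], of b a] assms by (simp add: algebra_simps)
qed simp

text \<open>The marginal reward \<open>D\<close> on the link to \<open>w\<close> acts as a price of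
  budget. Only on that link can more than the target be effective; on all others the effective
  amount is at most the target and the slope there is at least \<open>D\<close> if the target is
  positive. So the gain grows by at most \<open>D\<close> times the growth of effective spending,
  which is not positive because the targets exhaust the budget.\<close>

lemma owner_optimal:
  assumes uw: "{u, w} \<in> links G" "r u < r w" and p: "p \<in> strategies G u"
    and c: "\<And>e. e \<in> incident G u \<Longrightarrow> 0 \<le> c e"
      "\<And>e. e \<in> incident G u \<Longrightarrow> e \<noteq> {u, w} \<Longrightarrow> c e = x e"
  shows "gain u p c \<le> gain u x x"
proof -
  define y where "y e = min (p e) (c e)" for e
  define D where "D = d {u, w} (x {u, w})"
  have D: "0 < D" using pos[OF uw(1) x_nonneg[OF uw(1)]] by (simp add: D_def)
  have y: "0 \<le> y e" "y e \<le> p e" if "e \<in> incident G u" for e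
    using strategies_nonneg[OF p that] c(1)[OF that] by (auto simp: y_def)
  have "gain u p c - gain u x x = (\<Sum>e\<in>incident G u. h e (y e) - h e (x e))"
    by (simp add: gain_def y_def sum_subtractf)
  also have "\<dots> \<le> (\<Sum>e\<in>incident G u. D * (y e - x e))"
  proof (rule sum_mono)
    fix e assume e: "e \<in> incident G u"
    then have link: "e \<in> links G" by (simp add: incident_def)
    have x0: "0 \<le> x e" by (rule x_nonneg[OF link])
    have "h e (y e) - h e (x e) \<le> d e (x e) * (y e - x e)"
      by (rule tangent_le[OF link x0 y(1)[OF e]])
    also have "\<dots> \<le> D * (y e - x e)"
    proof (cases "e = {u, w}")
      case True
      then show ?thesis by (simp add: D_def)
    next
      case False
      then have yx: "y e \<le> x e" using c(2)[OF e] by (simp add: y_def)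
      show ?thesis
      \<comment> \<open>For a zero target the slope has no lower bound by \<open>D\<close>, but then
        the effective amount is zero as well and both sides vanish.\<close>
      proof (cases "x e = 0")
        case True
        then show ?thesis using yx y(1)[OF e] by simp
      next
        case False
        have "edge_rank r e \<le> edge_rank r {u, w}" using edge_rank_le[OF e] uw(2) by simp
        then have "D \<le> d e (x e)" unfolding D_def using level_le link uw(1) x0 False by simp
        then show ?thesis using yx by (intro mult_right_mono_neg) auto
      qed
    qed
    finally show "h e (y e) - h e (x e) \<le> D * (y e - x e)" .
  qed
  also have "\<dots> = D * ((\<Sum>e\<in>incident G u. y e) - (\<Sum>e\<in>incident G u. x e))"
    by (simp add: sum_distrib_left sum_subtractf right_diff_distrib)
  also have "\<dots> \<le> 0"
  proof -
    have "(\<Sum>e\<in>incident G u. y e) \<le> (\<Sum>e\<in>incident G u. p e)" using y(2) by (rule sum_mono)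
    also have "\<dots> \<le> (\<Sum>e\<in>incident G u. x e)"
      using p owner_budget[OF uw] by (simp add: strategies_def)
    finally show ?thesis using D by (simp add: mult_le_0_iff)
  qed
  finally show ?thesis by simp
qed

lemma profile_state: "(\<lambda>_. x) \<in> states G"
  using x_strategy by (simp add: states_def)

lemma opposite_profile [simp]: "opposite (\<lambda>_. x) v = x"
  by (simp add: opposite_def fun_eq_iff)

lemma profile_utility: "v \<in> players G \<Longrightarrow> utility G v (\<lambda>_. x) = gain v x x"
  using utility_state[OF profile_state, of v] by simp

lemma gain_profile_le: "p \<in> strategies G v \<Longrightarrow> gain v p x \<le> gain v x x"
  using strategies_nonneg[of p v] x_nonneg by (intro gain_mono) (auto simp: incident_def)

text \<open>If the players are adjacent, \<open>u\<close> owns the common link and the deviation of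
  \<open>v\<close> changes only the cap on it, so \<open>owner_optimal\<close> applies; players
  without a common link do not affect each other. In every pair at least one player is in the
  position of \<open>u\<close>, which excludes profitable bilateral deviations.\<close>

lemma profile_deviation_le:
  assumes u: "u \<in> players G" "u \<noteq> v" and p: "p \<in> strategies G u" and q: "q \<in> strategies G v"
    and r: "{u, v} \<in> links G \<Longrightarrow> r u < r v"
  shows "utility G u ((\<lambda>_. x)(u := p, v := q)) \<le> utility G u (\<lambda>_. x)"
proof -
  let ?s = "(\<lambda>_. x)(v := q)"
  have st: "?s \<in> states G" using profile_state q by (rule states_update)
  have "(\<lambda>_. x)(u := p, v := q) = ?s(u := p)" using u(2) by (simp add: fun_upd_twist)
  then have "utility G u ((\<lambda>_. x)(u := p, v := q)) = gain u p (opposite ?s u)"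
    using utility_update[OF st u(1) p] by simp
  also have "\<dots> \<le> gain u x x"
  proof (cases "{u, v} \<in> links G")
    case True
    show ?thesis
    proof (rule owner_optimal[OF True r[OF True] p])
      show "0 \<le> opposite ?s u e" if "e \<in> incident G u" for e using states_opposite[OF st that] .
      show "opposite ?s u e = x e" if "e \<in> incident G u" "e \<noteq> {u, v}" for e
        using opposite_update_other[OF that(1), of v] u(2) that(2) by (simp add: insert_commute)
    qed
  next
    case False
    have "gain u p (opposite ?s u) = gain u p x"
    proof (rule gain_cong)
      fix e assume e: "e \<in> incident G u"
      then have "e \<noteq> {v, u}" using False by (auto simp: incident_def insert_commute)
      then show "min (p e) (opposite ?s u e) = min (p e) (x e)"
        using opposite_update_other[OF e, of v] u(2) by simp
    qed
    then show ?thesis using gain_profile_le[OF p] by simp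
  qed
  finally show ?thesis using profile_utility[OF u(1)] by simp
qed

lemma profile_pairwise_equilibrium: "pairwise_equilibrium G (\<lambda>_. x)"
  unfolding pairwise_equilibrium_def
proof (intro conjI ballI impI notI)
  show "nash_equilibrium G (\<lambda>_. x)"
    unfolding nash_equilibrium_def
    using profile_state profile_utility utility_update[OF profile_state] gain_profile_le by simp
  fix u v assume uv: "u \<in> players G" "v \<in> players G" "u \<noteq> v"
    and "\<exists>p q. profitable_bilateral_deviation G (\<lambda>_. x) u v p q"
  then obtain p q where pq: "p \<in> strategies G u" "q \<in> strategies G v"
    "utility G u (\<lambda>_. x) < utility G u ((\<lambda>_. x)(u := p, v := q))"
    "utility G v (\<lambda>_. x) < utility G v ((\<lambda>_. x)(u := p, v := q))"
    by (auto simp: profitable_bilateral_deviation_def)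
  have tw: "(\<lambda>_. x)(u := p, v := q) = (\<lambda>_. x)(v := q, u := p)" using uv(3) by (simp add: fun_upd_twist)
  have "{u, v} \<in> links G \<and> \<not> r u < r v"
    using profile_deviation_le[OF uv(1,3) pq(1,2)] pq(3) by linarith
  then have "r v < r u" using r_neq[of u v] by simp
  then show False
    using profile_deviation_le[OF uv(2) uv(3)[symmetric] pq(2,1)] pq(4) unfolding tw by simp
qed

lemma profile_balanced: "balanced G (\<lambda>_. x)"
  by (simp add: balanced_def)

section \<open>Convergence along a single run\<close>

lemma run_states:
  assumes run: "br_run G K X" and P: "\<And>t. snd (K t) \<subseteq> links G"
  shows "X t \<in> states G"
proof (induction t)
  case 0
  show ?case using run by (simp add: br_run_def)
next
  case (Suc t)
  have "br_round G (fst (K t), snd (K t)) (X t) (X (Suc t))" using run by (simp add: br_run_def)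
  then show ?case using round_states[OF Suc P] by blast
qed

text \<open>The chance that secures a link has to come after all lower ranks have settled;
  infinitely many chances guarantee one that is late enough.\<close>

lemma run_eventually_secured_below:
  assumes run: "br_run G K X" and P: "\<And>t. snd (K t) \<subseteq> links G"
    and often: "\<And>e. e \<in> links G \<Longrightarrow> infinite {t. e \<in> snd (K t)}"
  shows "\<exists>T. \<forall>t\<ge>T. secured_below (X t) k"
proof (induction k)
  case 0
  then show ?case by (simp add: secured_below_def)
next
  case (Suc k)
  then obtain T where T: "\<And>t. t \<ge> T \<Longrightarrow> secured_below (X t) k" by blast
  have round: "br_round G (fst (K t), snd (K t)) (X t) (X (Suc t))" for t
    using run by (simp add: br_run_def)
  note keep = round_secured[OF run_states[OF run P] T P round]
  have "\<exists>T'. \<forall>t\<ge>T'. secured (X t) e" if e: "e \<in> links G" "edge_rank r e \<le> k" for e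
  proof -
    obtain t0 where t0: "t0 \<ge> T" "e \<in> snd (K t0)"
      using often[OF e(1)] by (auto simp: infinite_nat_iff_unbounded_le)
    have "secured (X t) e" if "t \<ge> Suc t0" for t
      using that
    proof (induction t rule: dec_induct)
      case base
      then show ?case using keep[OF t0(1) e] t0(2) by blast
    next
      case (step t)
      then show ?case using keep[of t] e t0(1) by simp
    qed
    then show ?thesis by blast
  qed
  then obtain T' where T': "\<And>e t. e \<in> links G \<Longrightarrow> edge_rank r e \<le> k \<Longrightarrow> t \<ge> T' e \<Longrightarrow> secured (X t) e"
    by metis
  \<comment> \<open>Inserting 0 keeps the maximum defined when there are no links.\<close>
  have "secured_below (X t) (Suc k)" if "t \<ge> Max (insert 0 (T' ` links G))" for t
    unfolding secured_below_def
  proof (intro ballI impI)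
    fix e assume e: "e \<in> links G" "edge_rank r e < Suc k"
    have "T' e \<le> Max (insert 0 (T' ` links G))" using finite_links e(1) by (intro Max_ge) auto
    then show "secured (X t) e" using T'[OF e(1)] e(2) that by simp
  qed
  then show ?case by blast
qed

lemma run_eventually_secured:
  assumes run: "br_run G K X" and P: "\<And>t. snd (K t) \<subseteq> links G"
    and often: "\<And>e. e \<in> links G \<Longrightarrow> infinite {t. e \<in> snd (K t)}"
  shows "\<exists>T. \<forall>t\<ge>T. all_secured (X t)"
proof -
  define k where "k = Suc (Max (insert 0 (edge_rank r ` links G)))"
  have "edge_rank r e < k" if "e \<in> links G" for e
    unfolding k_def less_Suc_eq_le using finite_links that by (intro Max_ge) auto
  then have "secured_below s k \<Longrightarrow> all_secured s" for s
    by (simp add: secured_below_def all_secured_def)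
  then show ?thesis using run_eventually_secured_below[OF assms, of k] by blast
qed

lemma run_converges:
  assumes run: "br_run G K X" and P: "\<And>t. snd (K t) \<subseteq> links G"
    and often: "\<And>e. e \<in> links G \<Longrightarrow> infinite {t. e \<in> snd (K t)}"
      "\<And>v. v \<in> players G \<Longrightarrow> infinite {t. v \<in> fst (K t)}"
  shows "\<exists>s. pairwise_equilibrium G s \<and> balanced G s \<and> converges_to G (\<lambda>t. effective (X t)) s \<and>
    (frugal_run G K X \<longrightarrow> converges_to G X s)"
proof (intro exI conjI impI)
  obtain T where T: "\<And>t. t \<ge> T \<Longrightarrow> all_secured (X t)"
    using run_eventually_secured[OF run P often(1)] by blast
  note st = run_states[OF run P]
  show "pairwise_equilibrium G (\<lambda>_. x)" by (rule profile_pairwise_equilibrium)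
  show "balanced G (\<lambda>_. x)" by (rule profile_balanced)
  show "converges_to G (\<lambda>t. effective (X t)) (\<lambda>_. x)"
    unfolding converges_to_def
  proof (intro ballI)
    fix v e assume e: "e \<in> incident G v"
    have "\<forall>\<^sub>F t in sequentially. effective (X t) v e = x e"
      using secured_effective[OF st T e] by (auto simp: eventually_sequentially)
    then show "(\<lambda>t. effective (X t) v e) \<longlonglongrightarrow> x e" by (rule tendsto_eventually)
  qed
  show "converges_to G X (\<lambda>_. x)" if frugal: "frugal_run G K X"
    unfolding converges_to_def
  proof (intro ballI)
    fix v e assume v: "v \<in> players G" and e: "e \<in> incident G v"
    have move: "X (Suc t) v e = x e" if t: "t \<ge> T" "v \<in> fst (K t)" for t
    proof (rule frugal_response_exact[OF st T[OF t(1)] st _ _ e])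
      show "all_secured (X (Suc t))" using T t(1) by simp
      show "X (Suc t) v {v, u} \<le> X t u {v, u}" if "u \<in> neighbors G v" for u
        using frugal that t(2) by (simp add: frugal_run_def)
    qed
    \<comment> \<open>A contribution that has reached its target stays there: unilateral responses
      are exact by frugality, and bilateral chances leave the pair unchanged.\<close>
    have stay: "X (Suc t) v e = x e" if t: "t \<ge> T" "X t v e = x e" for t
    proof -
      have "br_round G (fst (K t), snd (K t)) (X t) (X (Suc t))" using run by (simp add: br_run_def)
      from this v show ?thesis
      proof (cases rule: round_cases)
        case 1
        then show ?thesis using move t(1) by blast
      next
        case (2 e0)
        obtain a b p q where m: "e0 = {a, b}" "bilateral_candidate G (X t) a b p q"
          "if profitable_bilateral_deviation G (X t) a b p q
           then X (Suc t) a = p \<and> X (Suc t) b = q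
           else X (Suc t) a = X t a \<and> X (Suc t) b = X t b"
          using 2(3) unfolding bilateral_move_def by blast
        have "{a, b} \<in> links G" using 2(1) P m(1) by blast
        from secured_not_profitable[OF st T[OF t(1)] this m(2)]
        have "X (Suc t) a = X t a \<and> X (Suc t) b = X t b" using m(3) by simp
        then show ?thesis using 2(2) m(1) t(2) by auto
      next
        case 3
        then show ?thesis using t(2) by simp
      qed
    qed
    \<comment> \<open>A unilateral chance of \<open>v\<close> after \<open>T\<close> removes the
      surplus that it placed earlier.\<close>
    obtain t0 where t0: "t0 \<ge> T" "v \<in> fst (K t0)"
      using often(2)[OF v] by (auto simp: infinite_nat_iff_unbounded_le)
    have "X t v e = x e" if "t \<ge> Suc t0" for t
      using that
    proof (induction t rule: dec_induct)
      case base
      show ?case by (rule move[OF t0])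
    next
      case (step t)
      then show ?case using stay[of t] t0(1) by simp
    qed
    then have "\<forall>\<^sub>F t in sequentially. X t v e = x e" by (auto simp: eventually_sequentially)
    then show "(\<lambda>t. X t v e) \<longlonglongrightarrow> x e" by (rule tendsto_eventually)
  qed
qed

end

section \<open>Random choices\<close>

lemma profiled_game_exists:
  fixes G :: "'v contribution_game" and h :: "'v edge \<Rightarrow> real \<Rightarrow> real"
  assumes game: "contribution_game G"
    and reward: "\<And>e x y. e \<in> links G \<Longrightarrow> 0 \<le> x \<Longrightarrow> 0 \<le> y \<Longrightarrow> reward G e x y = h e (min x y)"
    and mono: "\<And>e. e \<in> links G \<Longrightarrow> mono_on {0..} (h e)"
    and diff: "\<And>e. e \<in> links G \<Longrightarrow> h e differentiable_on {0..}"
    and conc: "\<And>e. e \<in> links G \<Longrightarrow> strictly_concave_on {0..} (h e)"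
  shows "\<exists>d x r. profiled_game G h d x r"
proof -
  define d where "d e a = (SOME D. (h e has_real_derivative D) (at a within {0..}))" for e a
  have der: "(h e has_real_derivative d e a) (at a within {0..})" if "e \<in> links G" "0 \<le> a" for e a
  proof -
    have "\<exists>D. (h e has_real_derivative D) (at a within {0..})"
      using diff[OF that(1)] that(2) by (simp add: differentiable_on_def real_differentiable_def)
    then show ?thesis unfolding d_def by (rule someI_ex)
  qed
  have tangent: "tangent_bounds (h e) (d e)" if "e \<in> links G" for e
    by (rule strictly_concave_on_tangent_bounds[OF conc[OF that] der[OF that]])
  \<comment> \<open>Monotonicity gives only a nonnegative increment; the strict tangent bound over a
    step of length 1 turns it into a positive derivative.\<close>
  have pos: "0 < d e a" if "e \<in> links G" "0 \<le> a" for e a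
  proof -
    have "h e a \<le> h e (a + 1)" using mono_onD[OF mono[OF that(1)], of a "a + 1"] that(2) by simp
    moreover have "h e (a + 1) - h e a < d e a * (a + 1 - a)"
      by (rule tangent_boundsD(2)[OF tangent[OF that(1)] that(2)]) simp
    ultimately show ?thesis by simp
  qed
  interpret min_effort_game G h d
    by unfold_locales (fact game reward tangent pos)+
  \<comment> \<open>The initial level dominates every marginal reward at 0, so the zero allocation
    affords it. A sum provides such a bound even if there are no links.\<close>
  have "\<exists>x r. ranked_profile d (links G) (players G) (budget G) x r \<and>
      (\<forall>e\<in>links G. d e (x e) \<le> (\<Sum>f\<in>links G. d f 0))"
  proof (rule ranked_profile_exists[where h = h])
    have "d e 0 \<le> (\<Sum>f\<in>links G. d f 0)" if "e \<in> links G" for e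
      by (rule member_le_sum[OF that]) (use pos finite_links in \<open>auto intro: less_imp_le\<close>)
    moreover have "0 \<le> budget G v" if "v \<in> players G" for v
      using game that by (simp add: contribution_game_def)
    ultimately show "\<forall>v\<in>players G. \<exists>y. (\<forall>e\<in>links G. v \<in> e \<longrightarrow> 0 \<le> y e \<and> d e (y e) \<le> (\<Sum>f\<in>links G. d f 0)) \<and>
        (\<Sum>e | e \<in> links G \<and> v \<in> e. y e) \<le> budget G v"
      by (intro ballI exI[of _ "\<lambda>_. 0"]) simp
  qed (fact finite_players link_props der tangent pos)+
  then obtain x r where "ranked_profile d (links G) (players G) (budget G) x r" by blast
  then have "profiled_game G h d x r" by unfold_locales
  then show ?thesis by blast
qed

section \<open>Recurrence of independent choices\<close>

lemma (in prob_space) AE_infinitely_often: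
  assumes indep: "indep_events (\<lambda>t. {\<omega> \<in> space M. P t \<omega>}) (UNIV :: nat set)"
    and p: "0 < p" "\<And>t. p \<le> prob {\<omega> \<in> space M. P t \<omega>}"
  shows "AE \<omega> in M. infinite {t. P t \<omega>}"
  using borel_0_1_law_AE[OF indep]
proof
  assume fin: "AE \<omega> in M. finite {t. P t \<omega>}"
  have ev [measurable]: "{\<omega> \<in> space M. P t \<omega>} \<in> events" for t
    using indep by (auto simp: indep_events_def)
  \<comment> \<open>\<open>F n\<close> says that the event still occurs at time \<open>n\<close> or
    later. In the almost surely finite case of the zero-one law the intersection of all
    \<open>F n\<close> is null, although each has probability at least \<open>p\<close>; so that
    case is impossible.\<close>
  define F where "F n = (\<Union>t\<in>{n..}. {\<omega> \<in> space M. P t \<omega>})" for n :: nat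
  have F: "F n \<in> events" for n unfolding F_def by (intro sets.countable_UN) auto
  have "decseq F" by (fastforce simp: F_def decseq_def)
  then have "(\<lambda>n. prob (F n)) \<longlonglongrightarrow> prob (\<Inter>n. F n)"
    using F by (intro finite_Lim_measure_decseq) auto
  moreover have "p \<le> prob (F n)" for n
    using F by (intro order_trans[OF p(2)[of n]] finite_measure_mono) (auto simp: F_def)
  ultimately have "p \<le> prob (\<Inter>n. F n)" by (intro LIMSEQ_le_const) auto
  moreover have "AE \<omega> in M. \<omega> \<notin> (\<Inter>n. F n)"
    using fin
  proof eventually_elim
    case (elim \<omega>)
    then obtain k where "\<And>t. P t \<omega> \<Longrightarrow> t < k" by (auto simp: finite_nat_iff_bounded)
    then have "\<omega> \<notin> F k" by (force simp: F_def)
    then show ?case by blast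
  qed
  then have "prob (\<Inter>n. F n) = 0" using F by (subst prob_eq_0) auto
  ultimately show ?thesis using p(1) by simp
qed

lemma (in prob_space) prob_uniform_choice:
  assumes C: "random_variable (count_space UNIV) C"
    and distr: "distr M (count_space UNIV) C = measure_pmf (pmf_of_set S)"
    and S: "finite S" "a \<in> S"
  shows "prob {\<omega> \<in> space M. C \<omega> = a} = 1 / card S"
proof -
  have "{\<omega> \<in> space M. C \<omega> = a} = C -` {a} \<inter> space M" by auto
  then have "prob {\<omega> \<in> space M. C \<omega> = a} = measure (distr M (count_space UNIV) C) {a}"
    using C by (simp add: measure_distr)
  also have "\<dots> = pmf (pmf_of_set S) a" unfolding distr by (simp add: pmf.rep_eq)
  also have "\<dots> = 1 / card S" using S by (subst pmf_of_set) auto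
  finally show ?thesis .
qed

lemma (in prob_space) uniform_choice_infinitely_often:
  fixes C :: "nat \<Rightarrow> 'a \<Rightarrow> 'b"
  assumes indep: "indep_vars (\<lambda>_. count_space UNIV) C UNIV"
    and distr: "\<And>t. distr M (count_space UNIV) (C t) = measure_pmf (pmf_of_set S)"
    and S: "finite S" "a \<in> S"
  shows "AE \<omega> in M. infinite {t. C t \<omega> = a}"
proof (rule AE_infinitely_often)
  show "indep_events (\<lambda>t. {\<omega> \<in> space M. C t \<omega> = a}) UNIV"
    by (rule indep_eventsI_indep_vars[OF indep]) simp
  show "0 < 1 / real (card S)" using S by (auto simp: card_gt_0_iff)
  have "random_variable (count_space UNIV) (C t)" for t using indep by (simp add: indep_vars_def)
  from prob_uniform_choice[OF this distr S]
  show "1 / real (card S) \<le> prob {\<omega> \<in> space M. C t \<omega> = a}" for t by simp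
qed

text \<open>The choices of \<open>J\<close> in one round are bundled into a vector. Bundles of
  different rounds use disjoint index sets \<open>{t} \<times> J\<close> and are therefore
  independent, while independence within a round makes the probability of the prescribed bundle a
  product.\<close>

lemma (in prob_space) joint_choice_infinitely_often:
  fixes C :: "nat \<Rightarrow> 'i \<Rightarrow> 'a \<Rightarrow> 'b"
  assumes indep: "indep_vars (\<lambda>_. count_space UNIV) (\<lambda>(t, i). C t i) (UNIV \<times> I)"
    and distr: "\<And>t i. i \<in> I \<Longrightarrow> distr M (count_space UNIV) (C t i) = measure_pmf (pmf_of_set (S i))"
    and J: "finite J" "J \<noteq> {}" "J \<subseteq> I"
    and S: "\<And>i. i \<in> J \<Longrightarrow> finite (S i) \<and> c i \<in> S i"
  shows "AE \<omega> in M. infinite {t. \<forall>i\<in>J. C t i \<omega> = c i}"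
proof (rule AE_infinitely_often)
  define K where "K t = {t} \<times> J" for t :: nat
  let ?PiM = "\<lambda>t. PiM (K t) (\<lambda>_. count_space UNIV) :: (nat \<times> 'i \<Rightarrow> 'b) measure"
  have "indep_vars ?PiM (\<lambda>t \<omega>. restrict (\<lambda>i. (case i of (t, i) \<Rightarrow> C t i) \<omega>) (K t)) UNIV"
    using J by (intro indep_vars_restrict[OF indep]) (auto simp: K_def disjoint_family_on_def)
  then have "indep_events (\<lambda>t. {\<omega> \<in> space M. \<forall>i\<in>J.
      restrict (\<lambda>i. (case i of (t, i) \<Rightarrow> C t i) \<omega>) (K t) (t, i) = c i}) UNIV"
  proof (rule indep_eventsI_indep_vars)
    fix t :: nat
    have "{f \<in> space (?PiM t). \<forall>i\<in>J. f (t, i) = c i} = PiE (K t) (\<lambda>j. {c (snd j)})"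
      by (auto simp: space_PiM K_def PiE_iff extensional_def)
    also have "\<dots> \<in> sets (?PiM t)" using J(1) by (intro sets_PiM_I_finite) (auto simp: K_def)
    finally show "{f \<in> space (?PiM t). \<forall>i\<in>J. f (t, i) = c i} \<in> sets (?PiM t)" .
  qed
  then show "indep_events (\<lambda>t. {\<omega> \<in> space M. \<forall>i\<in>J. C t i \<omega> = c i}) UNIV"
    by (simp add: K_def cong: conj_cong)
  show "0 < (\<Prod>i\<in>J. 1 / real (card (S i)))"
    using S by (intro prod_pos) (auto simp: card_gt_0_iff)
  show "(\<Prod>i\<in>J. 1 / real (card (S i))) \<le> prob {\<omega> \<in> space M. \<forall>i\<in>J. C t i \<omega> = c i}" for t
  proof -
    have rv: "random_variable (count_space UNIV) (C t i)" if "i \<in> J" for i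
      using indep J(3) that by (force simp: indep_vars_def)
    have "{\<omega> \<in> space M. \<forall>i\<in>J. C t i \<omega> = c i} =
        (\<Inter>j\<in>{t} \<times> J. (\<lambda>(t, i). C t i) j -` {c (snd j)} \<inter> space M)"
      using J(2) by auto
    then have "prob {\<omega> \<in> space M. \<forall>i\<in>J. C t i \<omega> = c i} =
        (\<Prod>j\<in>{t} \<times> J. prob ((\<lambda>(t, i). C t i) j -` {c (snd j)} \<inter> space M))"
      using J by (simp only:) (rule indep_varsD[OF indep], auto)
    also have "\<dots> = (\<Prod>i\<in>J. prob {\<omega> \<in> space M. C t i \<omega> = c i})"
      by (rule prod.reindex_bij_witness[of _ "Pair t" snd]) (auto intro!: arg_cong[where f = prob])
    also have "\<dots> = (\<Prod>i\<in>J. 1 / real (card (S i)))"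
      using J(3) S by (intro prod.cong refl prob_uniform_choice rv distr) auto
    finally show ?thesis by simp
  qed
qed

section \<open>The two dynamics\<close>

theorem theorem7p4:
  fixes G :: "'v contribution_game"
    and h :: "'v edge \<Rightarrow> real \<Rightarrow> real"
    and M :: "'w measure"
    and C :: "nat \<Rightarrow> 'w \<Rightarrow> 'v + 'v edge"
    and D :: "nat \<Rightarrow> 'v \<Rightarrow> 'w \<Rightarrow> 'v"
    and X Y :: "nat \<Rightarrow> 'w \<Rightarrow> 'v state"
  assumes "contribution_game G"
    and "\<And>e x y. e \<in> links G \<Longrightarrow> 0 \<le> x \<Longrightarrow> 0 \<le> y \<Longrightarrow> reward G e x y = h e (min x y)"
    and "\<And>e. e \<in> links G \<Longrightarrow> mono_on {0..} (h e)"
    and "\<And>e. e \<in> links G \<Longrightarrow> h e differentiable_on {0..}"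
    and "\<And>e. e \<in> links G \<Longrightarrow> strictly_concave_on {0..} (h e)"
    and "prob_space M"
  shows "(random_br_dynamics G M C X \<longrightarrow>
      (AE \<omega> in M. \<exists>s. pairwise_equilibrium G s \<and> balanced G s \<and>
         converges_to G (\<lambda>t. effective (X t \<omega>)) s \<and>
         (frugal_run G (\<lambda>t. random_chances (C t \<omega>)) (\<lambda>t. X t \<omega>) \<longrightarrow>
            converges_to G (\<lambda>t. X t \<omega>) s))) \<and>
    (concurrent_br_dynamics G M D Y \<longrightarrow>
      (AE \<omega> in M. \<exists>s. pairwise_equilibrium G s \<and> balanced G s \<and>
         converges_to G (\<lambda>t. effective (Y t \<omega>)) s \<and>
         (frugal_run G (\<lambda>t. concurrent_chances G (\<lambda>v. D t v \<omega>)) (\<lambda>t. Y t \<omega>) \<longrightarrow>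
            converges_to G (\<lambda>t. Y t \<omega>) s)))"
proof (intro conjI impI)
  interpret prob_space M by fact
  obtain d x r where "profiled_game G h d x r"
    using profiled_game_exists[OF assms(1-5)] by blast
  then interpret profiled_game G h d x r .
  {
    assume dyn: "random_br_dynamics G M C X"
    define S where "S = players G <+> links G"
    have finS: "finite S" using finite_players finite_links by (simp add: S_def)
    have indep: "indep_vars (\<lambda>_. count_space UNIV) C UNIV"
      and distr: "\<And>t. distr M (count_space UNIV) (C t) = measure_pmf (pmf_of_set S)"
      and run: "AE \<omega> in M. br_run G (\<lambda>t. random_chances (C t \<omega>)) (\<lambda>t. X t \<omega>)"
      using dyn by (auto simp: random_br_dynamics_def S_def)
    show "AE \<omega> in M. \<exists>s. pairwise_equilibrium G s \<and> balanced G s \<and>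
         converges_to G (\<lambda>t. effective (X t \<omega>)) s \<and>
         (frugal_run G (\<lambda>t. random_chances (C t \<omega>)) (\<lambda>t. X t \<omega>) \<longrightarrow>
            converges_to G (\<lambda>t. X t \<omega>) s)"
    \<comment> \<open>Without players the set of objects is empty and \<open>pmf_of_set\<close> has
      no specified value, so nothing is known about the choices; convergence then holds
      vacuously.\<close>
    proof (cases "players G = {}")
      case True
      then show ?thesis using profile_pairwise_equilibrium profile_balanced
        by (intro AE_I2 exI[of _ "\<lambda>_. x"]) (simp add: converges_to_def)
    next
      case False
      then have "S \<noteq> {}" by (simp add: S_def)
      \<comment> \<open>Choices outside \<open>S\<close> are null events rather than impossible, and
        \<open>run_converges\<close> requires every chosen pair to be a link.\<close>
      have "AE \<omega> in M. C t \<omega> \<in> S" for t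
      proof -
        have rv: "C t \<in> M \<rightarrow>\<^sub>M count_space UNIV" using indep by (simp add: indep_vars_def)
        have "AE a in distr M (count_space UNIV) (C t). a \<in> S"
          unfolding distr using finS \<open>S \<noteq> {}\<close> by (simp add: AE_measure_pmf_iff)
        then show ?thesis by (rule AE_distrD[OF rv])
      qed
      then have "AE \<omega> in M. \<forall>t. C t \<omega> \<in> S" by (simp add: AE_all_countable)
      moreover have "AE \<omega> in M. \<forall>a\<in>S. infinite {t. C t \<omega> = a}"
        using finS by (intro AE_finite_allI uniform_choice_infinitely_often[OF indep distr])
      ultimately show ?thesis using run
      proof eventually_elim
        case (elim \<omega>)
        show ?case
        proof (rule run_converges)
          show "br_run G (\<lambda>t. random_chances (C t \<omega>)) (\<lambda>t. X t \<omega>)" using elim by simp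
          show "snd (random_chances (C t \<omega>)) \<subseteq> links G" for t
            using elim(1)[rule_format, of t] by (auto simp: S_def)
          show "infinite {t. e \<in> snd (random_chances (C t \<omega>))}" if "e \<in> links G" for e
          proof (rule infinite_super)
            show "infinite {t. C t \<omega> = Inr e}" using elim(2) that unfolding S_def by blast
          qed auto
          show "infinite {t. v \<in> fst (random_chances (C t \<omega>))}" if "v \<in> players G" for v
          proof (rule infinite_super)
            show "infinite {t. C t \<omega> = Inl v}" using elim(2) that unfolding S_def by blast
          qed auto
        qed
      qed
    qed
  }
  {
    assume dyn: "concurrent_br_dynamics G M D Y"
    define N where "N v = insert v (neighbors G v)" for v
    have indep: "indep_vars (\<lambda>_. count_space UNIV) (\<lambda>(t, v). D t v) (UNIV \<times> players G)"
      and distr: "\<And>t v. v \<in> players G \<Longrightarrow>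
        distr M (count_space UNIV) (D t v) = measure_pmf (pmf_of_set (N v))"
      and run: "AE \<omega> in M. br_run G (\<lambda>t. concurrent_chances G (\<lambda>v. D t v \<omega>)) (\<lambda>t. Y t \<omega>)"
      using dyn by (auto simp: concurrent_br_dynamics_def N_def)
    have "neighbors G v \<subseteq> players G" for v using link_doubletonD by (auto simp: neighbors_def)
    then have finN: "finite (N v)" for v
      unfolding N_def using finite_players by (auto intro: finite_subset)
    note often = joint_choice_infinitely_often[OF indep distr]
    have single: "AE \<omega> in M. infinite {t. D t v \<omega> = v}" if "v \<in> players G" for v
      using often[of "{v}" "\<lambda>v. v"] that finN by (simp add: N_def)
    have pair: "AE \<omega> in M. infinite {t. \<exists>u v. e = {u, v} \<and> D t u \<omega> = v \<and> D t v \<omega> = u}"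
      if link: "e \<in> links G" for e
    proof -
      obtain u v where e: "e = {u, v}" using link_props[OF link] by (auto simp: card_2_iff)
      note uv = link_doubletonD[OF link[unfolded e]]
      \<comment> \<open>Both endpoints have to name each other in the same round; as
        \<open>u\<close> and \<open>v\<close> differ, the conditional prescribes \<open>v\<close> to
        \<open>u\<close> and \<open>u\<close> to \<open>v\<close>.\<close>
      have "AE \<omega> in M. infinite {t. \<forall>i\<in>{u, v}. D t i \<omega> = (if i = u then v else u)}"
        using link uv finN by (intro often) (auto simp: e N_def neighbors_def insert_commute)
      then show ?thesis
      proof eventually_elim
        case (elim \<omega>)
        show ?case by (rule infinite_super[OF _ elim]) (use uv in \<open>auto simp: e\<close>)
      qed
    qed
    have "AE \<omega> in M. \<forall>v\<in>players G. infinite {t. D t v \<omega> = v}"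
      using finite_players single by (intro AE_finite_allI)
    moreover have "AE \<omega> in M. \<forall>e\<in>links G. infinite {t. \<exists>u v. e = {u, v} \<and> D t u \<omega> = v \<and> D t v \<omega> = u}"
      using finite_links pair by (intro AE_finite_allI)
    ultimately show "AE \<omega> in M. \<exists>s. pairwise_equilibrium G s \<and> balanced G s \<and>
         converges_to G (\<lambda>t. effective (Y t \<omega>)) s \<and>
         (frugal_run G (\<lambda>t. concurrent_chances G (\<lambda>v. D t v \<omega>)) (\<lambda>t. Y t \<omega>) \<longrightarrow>
            converges_to G (\<lambda>t. Y t \<omega>) s)"
      using run
    proof eventually_elim
      case (elim \<omega>)
      show ?case
      proof (rule run_converges)
        show "br_run G (\<lambda>t. concurrent_chances G (\<lambda>v. D t v \<omega>)) (\<lambda>t. Y t \<omega>)" using elim by simp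
        show "snd (concurrent_chances G (\<lambda>v. D t v \<omega>)) \<subseteq> links G" for t
          by (auto simp: concurrent_chances_def)
        show "infinite {t. e \<in> snd (concurrent_chances G (\<lambda>v. D t v \<omega>))}" if "e \<in> links G" for e
        proof (rule infinite_super)
          show "infinite {t. \<exists>u v. e = {u, v} \<and> D t u \<omega> = v \<and> D t v \<omega> = u}"
            using elim(2) that by blast
        qed (use that in \<open>auto simp: concurrent_chances_def\<close>)
        show "infinite {t. v \<in> fst (concurrent_chances G (\<lambda>v. D t v \<omega>))}" if "v \<in> players G" for v
        proof (rule infinite_super)
          show "infinite {t. D t v \<omega> = v}" using elim(1) that by blast
        qed (use that in \<open>auto simp: concurrent_chances_def\<close>)
      qed
    qed
  }
qed

end
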